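(* Let $\mathsf{CEP}$ be the class of Boolean frames having the congruence extension property. Neither $\mathsf{CEP}$ nor its complement (the class of Boolean frames not having the congruence extension property) is elementary, i.e. neither is axiomatizable by a set of first-order sentences in the language of Boolean frames.
   Context: A Boolean frame is an algebra $\mathfrak{A}=\langle A,\sqcap,-,0,f\rangle$ where $\langle A,\sqcap,-,0\rangle$ is a Boolean algebra and $f:A\to A$ is an arbitrary unary function. An algebra $\mathfrak{A}$ has the congruence extension property if for every subalgebra $\mathfrak{B}\subseteq\mathfrak{A}$ and every $\Theta\in\operatorname{Con}(\mathfrak{B})$ there is $\Psi\in\operatorname{Con}(\mathfrak{A})$ with $\Theta=\Psi\cap(B\times B)$. *)

theory Defs
  imports Main
begin

text \<open>
  Subalgebras of an algebra, and algebras of different sizes, have to live in one type, so an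
  algebra carries its underlying set explicitly. The operations are total on the type; only their
  values on the underlying set matter to the notions below.
\<close>

record 'a bf_algebra =
  univ :: "'a set"
  meet :: "'a \<Rightarrow> 'a \<Rightarrow> 'a"
  compl :: "'a \<Rightarrow> 'a"
  zero :: 'a
  oper :: "'a \<Rightarrow> 'a"

definition subuniverse :: "'a set \<Rightarrow> 'a bf_algebra \<Rightarrow> bool" where
  "subuniverse B A \<longleftrightarrow>
     B \<subseteq> univ A \<and> zero A \<in> B \<and>
     (\<forall>x\<in>B. \<forall>y\<in>B. meet A x y \<in> B) \<and>
     (\<forall>x\<in>B. compl A x \<in> B) \<and>
     (\<forall>x\<in>B. oper A x \<in> B)"

definition bf_algebra :: "'a bf_algebra \<Rightarrow> bool" where
  "bf_algebra A \<longleftrightarrow> subuniverse (univ A) A"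

definition subalgebra :: "'a bf_algebra \<Rightarrow> 'a bf_algebra \<Rightarrow> bool" where
  "subalgebra \<BB> A \<longleftrightarrow> (\<exists>B. subuniverse B A \<and> \<BB> = A\<lparr>univ := B\<rparr>)"

definition join :: "'a bf_algebra \<Rightarrow> 'a \<Rightarrow> 'a \<Rightarrow> 'a" where
  "join A x y = compl A (meet A (compl A x) (compl A y))"

definition one :: "'a bf_algebra \<Rightarrow> 'a" where
  "one A = compl A (zero A)"

text \<open>
  The axioms are those of \<^locale>\<open>abstract_boolean_algebra\<close>, relativised to the underlying set.
  The one-element algebra is a Boolean algebra, and \<^const>\<open>oper\<close> is an arbitrary function.
\<close>

definition boolean_frame :: "'a bf_algebra \<Rightarrow> bool" where
  "boolean_frame A \<longleftrightarrow> bf_algebra A \<and>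
     (\<forall>x\<in>univ A. \<forall>y\<in>univ A. \<forall>z\<in>univ A.
        meet A (meet A x y) z = meet A x (meet A y z) \<and>
        join A (join A x y) z = join A x (join A y z) \<and>
        meet A x (join A y z) = join A (meet A x y) (meet A x z) \<and>
        join A x (meet A y z) = meet A (join A x y) (join A x z)) \<and>
     (\<forall>x\<in>univ A. \<forall>y\<in>univ A. meet A x y = meet A y x \<and> join A x y = join A y x) \<and>
     (\<forall>x\<in>univ A.
        meet A x (one A) = x \<and> join A x (zero A) = x \<and>
        meet A x (compl A x) = zero A \<and> join A x (compl A x) = one A)"

lemma boolean_frame_UNIV_iff:
  assumes "univ A = UNIV"
  shows "boolean_frame A \<longleftrightarrow>
    abstract_boolean_algebra (meet A) (join A) (compl A) (zero A) (one A)"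
proof -
  have univ: "x \<in> univ A" for x
    using assms by simp
  show ?thesis
    unfolding boolean_frame_def bf_algebra_def subuniverse_def abstract_boolean_algebra_def
      abstract_boolean_algebra_axioms_def abel_semigroup_def abel_semigroup_axioms_def
      semigroup_def Ball_def
    by (simp only: univ) blast
qed

definition congruence :: "'a bf_algebra \<Rightarrow> ('a \<times> 'a) set \<Rightarrow> bool" where
  "congruence A \<Theta> \<longleftrightarrow> equiv (univ A) \<Theta> \<and>
     (\<forall>(x, x') \<in> \<Theta>. \<forall>(y, y') \<in> \<Theta>. (meet A x y, meet A x' y') \<in> \<Theta>) \<and>
     (\<forall>(x, x') \<in> \<Theta>. (compl A x, compl A x') \<in> \<Theta>) \<and>
     (\<forall>(x, x') \<in> \<Theta>. (oper A x, oper A x') \<in> \<Theta>)"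

definition congruence_extension_property :: "'a bf_algebra \<Rightarrow> bool" where
  "congruence_extension_property A \<longleftrightarrow>
     (\<forall>\<BB> \<Theta>. subalgebra \<BB> A \<longrightarrow> congruence \<BB> \<Theta> \<longrightarrow>
        (\<exists>\<Psi>. congruence A \<Psi> \<and> \<Theta> = \<Psi> \<inter> (univ \<BB> \<times> univ \<BB>)))"

definition CEP :: "'a bf_algebra set" where
  "CEP = {A. boolean_frame A \<and> congruence_extension_property A}"

definition non_CEP :: "'a bf_algebra set" where
  "non_CEP = {A. boolean_frame A \<and> \<not> congruence_extension_property A}"

text \<open>
  First-order logic with equality over the language of Boolean frames, with named variables.
  The remaining connectives and the existential quantifier are definable.
\<close>

datatype tm = Var nat | Zero | Compl tm | Meet tm tm | Oper tm

datatype fm = Eq tm tm | Neg fm | Conj fm fm | All nat fm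

primrec tm_vars :: "tm \<Rightarrow> nat set" where
  "tm_vars (Var n) = {n}"
| "tm_vars Zero = {}"
| "tm_vars (Compl t) = tm_vars t"
| "tm_vars (Meet s t) = tm_vars s \<union> tm_vars t"
| "tm_vars (Oper t) = tm_vars t"

primrec free_vars :: "fm \<Rightarrow> nat set" where
  "free_vars (Eq s t) = tm_vars s \<union> tm_vars t"
| "free_vars (Neg \<phi>) = free_vars \<phi>"
| "free_vars (Conj \<phi> \<psi>) = free_vars \<phi> \<union> free_vars \<psi>"
| "free_vars (All n \<phi>) = free_vars \<phi> - {n}"

definition sentence :: "fm \<Rightarrow> bool" where
  "sentence \<phi> \<longleftrightarrow> free_vars \<phi> = {}"

primrec tm_value :: "'a bf_algebra \<Rightarrow> (nat \<Rightarrow> 'a) \<Rightarrow> tm \<Rightarrow> 'a" where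
  "tm_value A e (Var n) = e n"
| "tm_value A e Zero = zero A"
| "tm_value A e (Compl t) = compl A (tm_value A e t)"
| "tm_value A e (Meet s t) = meet A (tm_value A e s) (tm_value A e t)"
| "tm_value A e (Oper t) = oper A (tm_value A e t)"

primrec satisfies :: "'a bf_algebra \<Rightarrow> (nat \<Rightarrow> 'a) \<Rightarrow> fm \<Rightarrow> bool" where
  "satisfies A e (Eq s t) \<longleftrightarrow> tm_value A e s = tm_value A e t"
| "satisfies A e (Neg \<phi>) \<longleftrightarrow> \<not> satisfies A e \<phi>"
| "satisfies A e (Conj \<phi> \<psi>) \<longleftrightarrow> satisfies A e \<phi> \<and> satisfies A e \<psi>"
| "satisfies A e (All n \<phi>) \<longleftrightarrow> (\<forall>a\<in>univ A. satisfies A (e(n := a)) \<phi>)"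

definition models :: "'a bf_algebra \<Rightarrow> fm set \<Rightarrow> bool" where
  "models A \<Sigma> \<longleftrightarrow> (\<forall>\<phi>\<in>\<Sigma>. \<forall>e. range e \<subseteq> univ A \<longrightarrow> satisfies A e \<phi>)"

text \<open>
  A class of algebras is represented by its members whose elements are drawn from \<open>'a\<close>.
  A set of sentences axiomatizing a class of algebras of all sizes also axiomatizes the members
  of that class over \<open>'a\<close>, so non-axiomatizability over one \<open>'a\<close> implies that of the
  whole class. For CEP frames over an infinite \<open>'a\<close> the converse holds too: the language is
  countable, and CEP passes to subalgebras while its failure passes to some countable elementary
  subalgebra. A finite \<open>'a\<close> has to be excluded, since every isomorphism-closed class of algebras
  over it is axiomatizable.
\<close>

definition elementary :: "'a bf_algebra set \<Rightarrow> bool" where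
  "elementary K \<longleftrightarrow>
     (\<exists>\<Sigma>. (\<forall>\<phi>\<in>\<Sigma>. sentence \<phi>) \<and> K = {A. bf_algebra A \<and> models A \<Sigma>})"

end

theory Submission
  imports Defs "HOL-Library.Countable_Set"
begin

text \<open>
  An elementary class is closed under elementary equivalence. So a single pair of elementarily
  equivalent Boolean frames, one with and one without the congruence extension property, refutes
  both claims of axiomatizability at once.

  The frame with the property is the power set of the natural numbers with the operation that
  sends \<open>{}\<close> to \<open>{}\<close>, the set \<open>{0}\<close> to \<open>{1..}\<close>, and any other nonempty \<open>X\<close> to the
  tail that starts one step below the minimum of \<open>X\<close> (or to \<open>UNIV\<close> if the minimum is 0).
  Iterating it leads from every nonempty set to \<open>UNIV\<close>. A congruence of a subalgebra that
  identifies two different elements identifies some \<open>x \<noteq> 0\<close> with 0, hence, by iteration, also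
  1 with 0. So every subalgebra has only the two trivial congruences, and these extend
  (\<open>congruence_extension_property_if_reaches_one\<close>).

  The number of iterations is unbounded, and this is what an ultrapower over a nonprincipal
  ultrafilter detects. There, let \<open>N\<close> be the tail that starts at an infinite number. Each step
  moves the start down by one only, so the sets that are empty below some infinite number at
  finite distance from \<open>N\<close>'s start form an ideal. Together with their complements, which the
  operation sends to 1, they form a subalgebra \<open>C\<close>, and modulo the ideal only 0 and 1 remain; so
  \<open>C\<close> has a congruence that identifies \<open>N\<close> with 0 but not 1 with 0. In the presence of
  \<open>{0}\<close>, which does not belong to \<open>C\<close>, identifying \<open>N\<close> with 0 collapses everything: it
  identifies \<open>{0} \<union> N\<close> with \<open>{0}\<close>, hence their images \<open>UNIV\<close> and \<open>{1..}\<close>, hence the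
  complements \<open>{}\<close> and \<open>{0}\<close>, and applying the operation twice gives 0 and 1. The exceptional
  value at \<open>{0}\<close> was chosen for this. So the congruence of \<open>C\<close> does not extend
  (\<open>not_congruence_extension_property_tail_ultrapower\<close>).

  The frame and its ultrapower are elementarily equivalent by the theorem of Los, but
  uncountable. The downward Loewenheim-Skolem theorem provides countable elementary subalgebras,
  and these have isomorphic copies inside any infinite type. Both sides of the argument survive
  the passage: every element still reaches 1, and the second subalgebra can be made to contain
  \<open>N\<close> and \<open>{0}\<close>.
\<close>

section \<open>Elementary equivalence\<close>

text \<open>
  Countability of the syntax keeps the Skolem hull of a countable set countable.
\<close>

instance tm :: countable by countable_datatype
instance fm :: countable by countable_datatype

lemma finite_tm_vars: "finite (tm_vars t)"
  by (induction t) auto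

lemma finite_free_vars: "finite (free_vars \<phi>)"
  by (induction \<phi>) (auto simp: finite_tm_vars)

lemma tm_value_cong:
  "(\<And>n. n \<in> tm_vars t \<Longrightarrow> e n = e' n) \<Longrightarrow> tm_value A e t = tm_value A e' t"
  by (induction t) auto

lemma satisfies_cong:
  "(\<And>n. n \<in> free_vars \<phi> \<Longrightarrow> e n = e' n) \<Longrightarrow> satisfies A e \<phi> \<longleftrightarrow> satisfies A e' \<phi>"
proof (induction \<phi> arbitrary: e e')
  case (Eq s t)
  have "tm_value A e s = tm_value A e' s" "tm_value A e t = tm_value A e' t"
    using Eq by (intro tm_value_cong; simp)+
  then show ?case by simp
next
  case (Neg \<phi>)
  have "satisfies A e \<phi> \<longleftrightarrow> satisfies A e' \<phi>"
    using Neg.prems by (intro Neg.IH) simp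
  then show ?case by simp
next
  case (Conj \<phi> \<psi>)
  have "satisfies A e \<phi> \<longleftrightarrow> satisfies A e' \<phi>"
    using Conj.prems by (intro Conj.IH) simp
  moreover have "satisfies A e \<psi> \<longleftrightarrow> satisfies A e' \<psi>"
    using Conj.prems by (intro Conj.IH) simp
  ultimately show ?case by simp
next
  case (All n \<phi>)
  have "satisfies A (e(n := a)) \<phi> \<longleftrightarrow> satisfies A (e'(n := a)) \<phi>" for a
    using All.prems by (intro All.IH) auto
  then show ?case by simp
qed

lemma satisfies_sentence:
  "sentence \<phi> \<Longrightarrow> satisfies A e \<phi> \<longleftrightarrow> satisfies A e' \<phi>"
  by (rule satisfies_cong) (simp add: sentence_def)

lemma tm_value_in_univ:
  "bf_algebra A \<Longrightarrow> range e \<subseteq> univ A \<Longrightarrow> tm_value A e t \<in> univ A"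
  by (induction t) (auto simp: bf_algebra_def subuniverse_def)

text \<open>
  The truth of a sentence does not depend on the assignment, so quantifying over all assignments,
  independently on both sides, says the same as comparing a single pair of them.
\<close>

definition elementarily_equivalent :: "'a bf_algebra \<Rightarrow> 'b bf_algebra \<Rightarrow> bool" where
  "elementarily_equivalent A B \<longleftrightarrow>
     (\<forall>\<phi> e e'. sentence \<phi> \<longrightarrow> satisfies A e \<phi> \<longleftrightarrow> satisfies B e' \<phi>)"

lemma elementarily_equivalentI:
  assumes "\<And>\<phi>. sentence \<phi> \<Longrightarrow> satisfies A e \<phi> \<longleftrightarrow> satisfies B e' \<phi>"
  shows "elementarily_equivalent A B"
  unfolding elementarily_equivalent_def using assms satisfies_sentence by metis

lemma elementarily_equivalent_sym:
  "elementarily_equivalent A B \<Longrightarrow> elementarily_equivalent B A"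
  unfolding elementarily_equivalent_def by blast

lemma elementarily_equivalent_trans:
  "elementarily_equivalent A B \<Longrightarrow> elementarily_equivalent B C \<Longrightarrow> elementarily_equivalent A C"
  unfolding elementarily_equivalent_def by meson

lemma elementary_closed:
  assumes "elementary K" "A \<in> K" "elementarily_equivalent A B" "bf_algebra B"
  shows "B \<in> K"
proof -
  obtain \<Sigma> where \<Sigma>: "\<forall>\<phi>\<in>\<Sigma>. sentence \<phi>" and K: "K = {A. bf_algebra A \<and> models A \<Sigma>}"
    using \<open>elementary K\<close> unfolding elementary_def by blast
  have "range (\<lambda>_. zero A) \<subseteq> univ A"
    using \<open>A \<in> K\<close> K by (auto simp: bf_algebra_def subuniverse_def)
  then have "satisfies A (\<lambda>_. zero A) \<phi>" if "\<phi> \<in> \<Sigma>" for \<phi>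
    using \<open>A \<in> K\<close> K that unfolding models_def by blast
  then have "models B \<Sigma>"
    using \<Sigma> \<open>elementarily_equivalent A B\<close>
    unfolding models_def elementarily_equivalent_def by blast
  then show ?thesis
    using K \<open>bf_algebra B\<close> by simp
qed

text \<open>
  Being a Boolean frame is expressed by one sentence, so that it can be transferred along
  elementary equivalence instead of being checked again for ultrapowers, subalgebras and copies.
\<close>

definition Join :: "tm \<Rightarrow> tm \<Rightarrow> tm" where
  "Join s t = Compl (Meet (Compl s) (Compl t))"

definition boolean_axiom :: fm where
  "boolean_axiom =
    (let x = Var 0; y = Var 1; z = Var 2; one = Compl Zero in
     All 0 (All 1 (All 2
      (Conj (Eq (Meet (Meet x y) z) (Meet x (Meet y z)))
      (Conj (Eq (Join (Join x y) z) (Join x (Join y z)))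
      (Conj (Eq (Meet x (Join y z)) (Join (Meet x y) (Meet x z)))
      (Conj (Eq (Join x (Meet y z)) (Meet (Join x y) (Join x z)))
      (Conj (Eq (Meet x y) (Meet y x))
      (Conj (Eq (Join x y) (Join y x))
      (Conj (Eq (Meet x one) x)
      (Conj (Eq (Join x Zero) x)
      (Conj (Eq (Meet x (Compl x)) Zero)
            (Eq (Join x (Compl x)) one)))))))))))))"

lemma sentence_boolean_axiom: "sentence boolean_axiom"
  by (auto simp: sentence_def boolean_axiom_def Join_def Let_def)

lemma tm_value_Join: "tm_value A e (Join s t) = join A (tm_value A e s) (tm_value A e t)"
  by (simp add: Join_def join_def)

lemma boolean_frame_iff_boolean_axiom:
  "boolean_frame A \<longleftrightarrow> bf_algebra A \<and> satisfies A e boolean_axiom"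
proof (cases "bf_algebra A")
  case True
  then have "univ A \<noteq> {}"
    by (auto simp: bf_algebra_def subuniverse_def)
  with True show ?thesis
    by (simp add: boolean_frame_def boolean_axiom_def tm_value_Join Let_def
        flip: one_def) blast
qed (simp add: boolean_frame_def)

lemma boolean_frame_elementarily_equivalent:
  "boolean_frame A \<Longrightarrow> bf_algebra B \<Longrightarrow> elementarily_equivalent A B \<Longrightarrow> boolean_frame B"
  using sentence_boolean_axiom
  unfolding elementarily_equivalent_def by (meson boolean_frame_iff_boolean_axiom)

section \<open>Isomorphic copies\<close>

definition isomorphism :: "('a \<Rightarrow> 'b) \<Rightarrow> 'a bf_algebra \<Rightarrow> 'b bf_algebra \<Rightarrow> bool" where
  "isomorphism h A B \<longleftrightarrow>
     bij_betw h (univ A) (univ B) \<and> h (zero A) = zero B \<and>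
     (\<forall>x\<in>univ A. \<forall>y\<in>univ A. h (meet A x y) = meet B (h x) (h y)) \<and>
     (\<forall>x\<in>univ A. h (compl A x) = compl B (h x)) \<and>
     (\<forall>x\<in>univ A. h (oper A x) = oper B (h x))"

lemma ex_isomorphic_copy:
  assumes "inj_on h (univ A)"
  shows "\<exists>B. isomorphism h A B"
proof
  let ?g = "inv_into (univ A) h"
  show "isomorphism h A
    \<lparr>univ = h ` univ A, meet = \<lambda>x y. h (meet A (?g x) (?g y)), compl = \<lambda>x. h (compl A (?g x)),
     zero = h (zero A), oper = \<lambda>x. h (oper A (?g x))\<rparr>"
    using assms by (auto simp: isomorphism_def bij_betw_def)
qed

lemma isomorphism_subuniverse:
  assumes iso: "isomorphism h A B" and S: "subuniverse S A"
  shows "subuniverse (h ` S) B"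
proof -
  have SA: "x \<in> univ A" if "x \<in> S" for x
    using S that by (auto simp: subuniverse_def)
  have im: "univ B = h ` univ A"
    using iso by (simp add: isomorphism_def bij_betw_def)
  have hom: "zero B = h (zero A)"
    "\<And>x y. x \<in> S \<Longrightarrow> y \<in> S \<Longrightarrow> meet B (h x) (h y) = h (meet A x y)"
    "\<And>x. x \<in> S \<Longrightarrow> compl B (h x) = h (compl A x)"
    "\<And>x. x \<in> S \<Longrightarrow> oper B (h x) = h (oper A x)"
    using iso SA by (auto simp: isomorphism_def)
  show ?thesis
    using S by (auto simp: subuniverse_def hom im)
qed

lemma isomorphism_bf_algebra:
  "isomorphism h A B \<Longrightarrow> bf_algebra A \<Longrightarrow> bf_algebra B"
  using isomorphism_subuniverse[of h A B "univ A"]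
  by (simp add: bf_algebra_def isomorphism_def bij_betw_def)

lemma isomorphism_tm_value:
  assumes "isomorphism h A B" "bf_algebra A" "range e \<subseteq> univ A"
  shows "tm_value B (h \<circ> e) t = h (tm_value A e t)"
  using assms tm_value_in_univ[OF assms(2,3)]
  by (induction t) (auto simp: isomorphism_def)

lemma isomorphism_satisfies:
  assumes "isomorphism h A B" "bf_algebra A" "range e \<subseteq> univ A"
  shows "satisfies B (h \<circ> e) \<phi> \<longleftrightarrow> satisfies A e \<phi>"
  using assms(3)
proof (induction \<phi> arbitrary: e)
  case (Eq s t)
  have "inj_on h (univ A)"
    using assms(1) by (simp add: isomorphism_def bij_betw_def)
  then show ?case
    unfolding satisfies.simps isomorphism_tm_value[OF assms(1,2) Eq]
    using tm_value_in_univ[OF assms(2) Eq] by (simp add: inj_on_eq_iff)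
next
  case (All n \<phi>)
  have "satisfies B ((h \<circ> e)(n := h a)) \<phi> \<longleftrightarrow> satisfies A (e(n := a)) \<phi>" if "a \<in> univ A" for a
  proof -
    have "range (e(n := a)) \<subseteq> univ A"
      using All.prems that by auto
    from All.IH[OF this] show ?thesis
      unfolding fun_upd_comp .
  qed
  moreover have "univ B = h ` univ A"
    using assms(1) by (simp add: isomorphism_def bij_betw_def)
  ultimately show ?case by (simp add: o_def)
qed auto

lemma isomorphism_elementarily_equivalent:
  assumes "isomorphism h A B" "bf_algebra A"
  shows "elementarily_equivalent A B"
proof (rule elementarily_equivalentI)
  fix \<phi>
  have "range (\<lambda>_. zero A) \<subseteq> univ A"
    using assms(2) by (auto simp: bf_algebra_def subuniverse_def)
  then show "satisfies A (\<lambda>_. zero A) \<phi> \<longleftrightarrow> satisfies B (h \<circ> (\<lambda>_. zero A)) \<phi>"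
    by (rule isomorphism_satisfies[OF assms, symmetric])
qed

lemma isomorphism_inverse:
  assumes iso: "isomorphism h A B" and A: "bf_algebra A"
  shows "isomorphism (inv_into (univ A) h) B A"
proof -
  let ?g = "inv_into (univ A) h"
  have inj: "inj_on h (univ A)" and im: "univ B = h ` univ A"
    using iso by (auto simp: isomorphism_def bij_betw_def)
  have gh: "?g (h x) = x" if "x \<in> univ A" for x
    using inj that by simp
  have hom: "meet B (h x) (h y) = h (meet A x y)" "compl B (h x) = h (compl A x)"
      "oper B (h x) = h (oper A x)" if "x \<in> univ A" "y \<in> univ A" for x y
    using iso that by (auto simp: isomorphism_def)
  have zero: "zero B = h (zero A)"
    using iso by (simp add: isomorphism_def)
  have clos: "meet A x y \<in> univ A" "compl A x \<in> univ A" "oper A x \<in> univ A"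
    if "x \<in> univ A" "y \<in> univ A" for x y
    using A that by (auto simp: bf_algebra_def subuniverse_def)
  have zero_in: "zero A \<in> univ A"
    using A by (auto simp: bf_algebra_def subuniverse_def)
  have "bij_betw ?g (univ B) (univ A)"
    using iso by (simp add: bij_betw_inv_into isomorphism_def)
  then show ?thesis
    unfolding isomorphism_def by (simp add: im zero zero_in gh hom clos)
qed

lemma isomorphism_restrict:
  assumes "isomorphism h A B" "S \<subseteq> univ A"
  shows "isomorphism h (A\<lparr>univ := S\<rparr>) (B\<lparr>univ := h ` S\<rparr>)"
  using assms unfolding isomorphism_def bij_betw_def
  by (auto simp: subset_iff intro: inj_on_subset)

text \<open>
  Injectivity is what makes the image relation transitive: a middle element has only one preimage.
\<close>

lemma isomorphism_congruence:
  assumes iso: "isomorphism h A B" and \<Theta>: "congruence A \<Theta>"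
  shows "congruence B (map_prod h h ` \<Theta>)"
proof -
  let ?\<Theta> = "map_prod h h ` \<Theta>"
  have inj: "inj_on h (univ A)" and im: "univ B = h ` univ A"
    using iso by (auto simp: isomorphism_def bij_betw_def)
  have hom: "meet B (h x) (h y) = h (meet A x y)" "compl B (h x) = h (compl A x)"
      "oper B (h x) = h (oper A x)" if "x \<in> univ A" "y \<in> univ A" for x y
    using iso that by (auto simp: isomorphism_def)
  have sub: "x \<in> univ A" "y \<in> univ A" if "(x, y) \<in> \<Theta>" for x y
    using \<Theta> that unfolding congruence_def equiv_def by auto
  have refl: "(x, x) \<in> \<Theta>" if "x \<in> univ A" for x
    using \<Theta> that by (auto simp: congruence_def equiv_def refl_on_def)
  have sym: "(y, x) \<in> \<Theta>" if "(x, y) \<in> \<Theta>" for x y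
    using \<Theta> that by (auto simp: congruence_def equiv_def dest: symD)
  have trans: "(x, z) \<in> \<Theta>" if "(x, y) \<in> \<Theta>" "(y, z) \<in> \<Theta>" for x y z
    using \<Theta> that by (auto simp: congruence_def equiv_def dest: transD)
  have comp: "(compl A x, compl A x') \<in> \<Theta>" "(oper A x, oper A x') \<in> \<Theta>"
    if "(x, x') \<in> \<Theta>" for x x'
    using \<Theta> that unfolding congruence_def by blast+
  have comp2: "(meet A x y, meet A x' y') \<in> \<Theta>"
    if "(x, x') \<in> \<Theta>" "(y, y') \<in> \<Theta>" for x x' y y'
    using \<Theta> that unfolding congruence_def by blast
  have I: "(h x, h y) \<in> ?\<Theta>" if "(x, y) \<in> \<Theta>" for x y
    using that by force
  have "equiv (univ B) ?\<Theta>"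
  proof (rule equivI)
    show "?\<Theta> \<subseteq> univ B \<times> univ B"
      using im sub by auto
    show "refl_on (univ B) ?\<Theta>"
      using im I refl by (auto simp: refl_on_def)
    show "sym ?\<Theta>"
      using I sym by (auto intro!: symI)
    show "trans ?\<Theta>"
    proof (rule transI)
      fix u v w assume "(u, v) \<in> ?\<Theta>" "(v, w) \<in> ?\<Theta>"
      then obtain x y y' z where *: "(x, y) \<in> \<Theta>" "(y', z) \<in> \<Theta>"
          "u = h x" "v = h y" "v = h y'" "w = h z"
        by auto
      then have "y = y'"
        using inj sub by (metis inj_onD)
      then show "(u, w) \<in> ?\<Theta>"
        using * I trans by blast
    qed
  qed
  moreover have "(meet B u v, meet B u' v') \<in> ?\<Theta>"
    if "(u, u') \<in> ?\<Theta>" "(v, v') \<in> ?\<Theta>" for u u' v v'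
    using that by (clarsimp simp: hom sub) (metis I comp2 hom(1) sub)
  moreover have "(compl B u, compl B u') \<in> ?\<Theta>" "(oper B u, oper B u') \<in> ?\<Theta>"
    if "(u, u') \<in> ?\<Theta>" for u u'
    using that by (clarsimp, metis I comp hom(2,3) sub)+
  ultimately show ?thesis
    unfolding congruence_def by blast
qed

text \<open>
  A congruence on a subalgebra is carried over, extended there, and the extension is carried back
  along the inverse.
\<close>

lemma congruence_extension_property_isomorphism:
  assumes iso: "isomorphism h A B" and A: "bf_algebra A"
    and cep: "congruence_extension_property B"
  shows "congruence_extension_property A"
  unfolding congruence_extension_property_def
proof (intro allI impI)
  fix \<CC> \<Theta>
  assume "subalgebra \<CC> A" and \<Theta>: "congruence \<CC> \<Theta>"
  then obtain S where S: "subuniverse S A" and \<CC>: "\<CC> = A\<lparr>univ := S\<rparr>"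
    unfolding subalgebra_def by blast
  have SA: "S \<subseteq> univ A"
    using S by (simp add: subuniverse_def)
  have inj: "inj_on h (univ A)" and im: "univ B = h ` univ A"
    using iso by (auto simp: isomorphism_def bij_betw_def)
  let ?g = "inv_into (univ A) h" and ?T = "B\<lparr>univ := h ` S\<rparr>"
  have "congruence ?T (map_prod h h ` \<Theta>)"
    using isomorphism_congruence[OF isomorphism_restrict[OF iso SA]] \<Theta> \<CC> by simp
  moreover have "subalgebra ?T B"
    using isomorphism_subuniverse[OF iso S] unfolding subalgebra_def by blast
  ultimately obtain \<Psi> where \<Psi>: "congruence B \<Psi>"
      and eq: "map_prod h h ` \<Theta> = \<Psi> \<inter> (h ` S \<times> h ` S)"
    using cep unfolding congruence_extension_property_def by fastforce
  have \<Theta>S: "\<Theta> \<subseteq> S \<times> S" and \<Psi>B: "\<Psi> \<subseteq> univ B \<times> univ B"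
    using \<Theta> \<Psi> unfolding \<CC> congruence_def equiv_def by auto
  have \<Theta>_iff: "(x, y) \<in> \<Theta> \<longleftrightarrow> (h x, h y) \<in> \<Psi>" if "x \<in> S" "y \<in> S" for x y
  proof
    assume "(h x, h y) \<in> \<Psi>"
    then have "(h x, h y) \<in> map_prod h h ` \<Theta>"
      using that eq by blast
    then obtain x' y' where *: "(x', y') \<in> \<Theta>" "h x = h x'" "h y = h y'"
      by auto
    then have "x = x'" "y = y'"
      using that \<Theta>S SA inj by (auto simp: subset_iff inj_on_def)
    with * show "(x, y) \<in> \<Theta>" by simp
  qed (use eq in force)
  have \<Psi>_iff: "(x, y) \<in> map_prod ?g ?g ` \<Psi> \<longleftrightarrow> (h x, h y) \<in> \<Psi>" if "x \<in> S" "y \<in> S" for x y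
  proof
    assume "(x, y) \<in> map_prod ?g ?g ` \<Psi>"
    then show "(h x, h y) \<in> \<Psi>"
      using \<Psi>B im by (auto simp: f_inv_into_f)
  next
    assume "(h x, h y) \<in> \<Psi>"
    moreover have "map_prod ?g ?g (h x, h y) = (x, y)"
      using that SA inj by (auto simp: subset_iff)
    ultimately show "(x, y) \<in> map_prod ?g ?g ` \<Psi>"
      by (metis image_eqI)
  qed
  have "\<Theta> = map_prod ?g ?g ` \<Psi> \<inter> (S \<times> S)"
  proof (rule set_eqI)
    fix p show "p \<in> \<Theta> \<longleftrightarrow> p \<in> map_prod ?g ?g ` \<Psi> \<inter> (S \<times> S)"
      using \<Theta>S \<Theta>_iff \<Psi>_iff by (cases p) blast
  qed
  then have "\<Theta> = map_prod ?g ?g ` \<Psi> \<inter> (univ \<CC> \<times> univ \<CC>)"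
    using \<CC> by simp
  moreover have "congruence A (map_prod ?g ?g ` \<Psi>)"
    using isomorphism_congruence[OF isomorphism_inverse[OF iso A] \<Psi>] .
  ultimately show "\<exists>\<Psi>. congruence A \<Psi> \<and> \<Theta> = \<Psi> \<inter> (univ \<CC> \<times> univ \<CC>)"
    by blast
qed


section \<open>The downward Loewenheim-Skolem theorem\<close>

text \<open>
  Closure under the operations is itself an instance of the witness property: the value of a
  term \<open>t\<close> is the only witness of the formula \<open>x = t\<close> with a fresh variable \<open>x\<close>.
\<close>

lemma tarski_vaught:
  assumes M: "bf_algebra M" and SM: "S \<subseteq> univ M" and "S \<noteq> {}"
    and witness: "\<And>\<phi> n e a. range e \<subseteq> S \<Longrightarrow> a \<in> univ M \<Longrightarrow> satisfies M (e(n := a)) \<phi> \<Longrightarrow>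
      \<exists>b\<in>S. satisfies M (e(n := b)) \<phi>"
  shows "subuniverse S M"
    and "\<And>\<phi> e. range e \<subseteq> S \<Longrightarrow> satisfies (M\<lparr>univ := S\<rparr>) e \<phi> \<longleftrightarrow> satisfies M e \<phi>"
proof -
  have tm: "tm_value M e t \<in> S" if e: "range e \<subseteq> S" for e t
  proof -
    \<comment> \<open>The fresh variable of the formula whose only witness is the value of \<open>t\<close>.\<close>
    obtain n where n: "n \<notin> tm_vars t"
      using ex_new_if_finite[OF infinite_UNIV_nat finite_tm_vars] by blast
    have cong: "tm_value M (e(n := b)) t = tm_value M e t" for b
      using n by (intro tm_value_cong) auto
    have "tm_value M e t \<in> univ M"
      using M SM e by (intro tm_value_in_univ) auto
    moreover have "satisfies M (e(n := tm_value M e t)) (Eq (Var n) t)"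
      using cong by simp
    ultimately obtain b where "b \<in> S" "satisfies M (e(n := b)) (Eq (Var n) t)"
      using witness[OF e] by blast
    then show ?thesis
      using cong by simp
  qed
  obtain s where s: "s \<in> S"
    using \<open>S \<noteq> {}\<close> by blast
  show "subuniverse S M"
    unfolding subuniverse_def
  proof (intro conjI ballI SM)
    show "zero M \<in> S"
      using tm[of "\<lambda>_. s" Zero] s by auto
    fix x assume x: "x \<in> S"
    show "compl M x \<in> S" "oper M x \<in> S"
      using tm[of "\<lambda>_. x" "Compl (Var 0)"] tm[of "\<lambda>_. x" "Oper (Var 0)"] x by auto
    fix y assume y: "y \<in> S"
    have "range ((\<lambda>_. y)(0 := x)) \<subseteq> S"
      using x y by auto
    from tm[OF this, of "Meet (Var 0) (Var 1)"] show "meet M x y \<in> S"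
      by simp
  qed
  have tm_eq: "tm_value (M\<lparr>univ := S\<rparr>) e t = tm_value M e t" for e t
    by (induction t) auto
  show "satisfies (M\<lparr>univ := S\<rparr>) e \<phi> \<longleftrightarrow> satisfies M e \<phi>" if "range e \<subseteq> S" for e \<phi>
    using that
  proof (induction \<phi> arbitrary: e)
    case (All n \<phi>)
    have IH: "satisfies (M\<lparr>univ := S\<rparr>) (e(n := b)) \<phi> \<longleftrightarrow> satisfies M (e(n := b)) \<phi>" if "b \<in> S" for b
      using that All.prems by (intro All.IH) auto
    have "\<exists>b\<in>S. \<not> satisfies M (e(n := b)) \<phi>"
      if "a \<in> univ M" "\<not> satisfies M (e(n := a)) \<phi>" for a
      using witness[OF All.prems that(1), of n "Neg \<phi>"] that(2) by simp
    then show ?case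
      using IH SM by auto
  qed (auto simp: tm_eq)
qed

text \<open>
  Close \<open>X\<close> under Skolem functions. There are uncountably many assignments into a countable
  infinite set, but a formula depends on a finite part of an assignment only; so the Skolem
  functions take finite lists of elements, padded with zero, as arguments.
\<close>

theorem downward_loewenheim_skolem:
  assumes M: "bf_algebra M" and X: "countable X" "X \<subseteq> univ M"
  obtains S where "countable S" "X \<subseteq> S" "subuniverse S M"
    "\<And>\<phi> e. range e \<subseteq> S \<Longrightarrow> satisfies (M\<lparr>univ := S\<rparr>) e \<phi> \<longleftrightarrow> satisfies M e \<phi>"
proof -
  define env where "env xs k = (if k < length xs then xs ! k else zero M)" for xs k
  \<comment> \<open>The chosen element is an actual witness if there is one, and always lies in the algebra.\<close>
  define wit where "wit = (\<lambda>(\<phi>, n, xs). SOME b. b \<in> univ M \<and>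
    ((\<exists>a\<in>univ M. satisfies M ((env xs)(n := a)) \<phi>) \<longrightarrow> satisfies M ((env xs)(n := b)) \<phi>))"
  define stage where
    "stage = rec_nat (insert (zero M) X) (\<lambda>_ Y. Y \<union> wit ` (UNIV \<times> UNIV \<times> lists Y))"
  have stage_simps: "stage 0 = insert (zero M) X"
    "stage (Suc k) = stage k \<union> wit ` (UNIV \<times> UNIV \<times> lists (stage k))" for k
    by (simp_all add: stage_def)
  have zero: "zero M \<in> univ M"
    using M by (simp add: bf_algebra_def subuniverse_def)
  have "\<exists>b. b \<in> univ M \<and>
    ((\<exists>a\<in>univ M. satisfies M ((env xs)(n := a)) \<phi>) \<longrightarrow> satisfies M ((env xs)(n := b)) \<phi>)" for xs n \<phi>
    using zero by blast
  from someI_ex[OF this]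
  have "wit (\<phi>, n, xs) \<in> univ M \<and> ((\<exists>a\<in>univ M. satisfies M ((env xs)(n := a)) \<phi>) \<longrightarrow>
      satisfies M ((env xs)(n := wit (\<phi>, n, xs))) \<phi>)" for \<phi> n xs
    unfolding wit_def prod.case .
  then have wit: "wit (\<phi>, n, xs) \<in> univ M"
    "a \<in> univ M \<Longrightarrow> satisfies M ((env xs)(n := a)) \<phi> \<Longrightarrow>
      satisfies M ((env xs)(n := wit (\<phi>, n, xs))) \<phi>" for \<phi> n xs a
    by blast+
  define S where "S = (\<Union>k. stage k)"
  have "stage k \<subseteq> univ M" for k
    using zero X wit by (induction k) (auto simp: stage_simps)
  then have SM: "S \<subseteq> univ M"
    unfolding S_def by blast
  have "countable (stage k)" for k
    using X by (induction k) (auto simp: stage_simps intro!: countable_SIGMA)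
  then have "countable S"
    unfolding S_def by blast
  have mono: "stage j \<subseteq> stage k" if "j \<le> k" for j k
    using lift_Suc_mono_le[of stage, OF _ that] by (simp add: stage_simps)
  have "X \<subseteq> S" "S \<noteq> {}"
    unfolding S_def using stage_simps(1) by blast+
  have "\<exists>b\<in>S. satisfies M (e(n := b)) \<phi>"
    if e: "range e \<subseteq> S" and a: "a \<in> univ M" "satisfies M (e(n := a)) \<phi>" for \<phi> n e a
  proof -
    obtain m where m: "\<And>k. k \<in> free_vars \<phi> \<Longrightarrow> k < m"
      using finite_free_vars by (metis finite_nat_set_iff_bounded)
    let ?xs = "map e [0..<m]"
    have cong: "satisfies M ((env ?xs)(n := b)) \<phi> \<longleftrightarrow> satisfies M (e(n := b)) \<phi>" for b
      using m by (intro satisfies_cong) (auto simp: env_def)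
    \<comment> \<open>The stages increase, so finitely many elements of \<open>S\<close> occur together in one stage.\<close>
    have "\<exists>k. ?xs \<in> lists (stage k)"
    proof (induction m)
      case (Suc m)
      then obtain k where "map e [0..<m] \<in> lists (stage k)"
        by blast
      moreover obtain l where "e m \<in> stage l"
        using e unfolding S_def by blast
      ultimately have "map e [0..<Suc m] \<in> lists (stage (max k l))"
        using mono[of k "max k l"] mono[of l "max k l"] by (auto simp: in_lists_conv_set)
      then show ?case by blast
    qed simp
    then obtain k where "?xs \<in> lists (stage k)" ..
    then have "wit (\<phi>, n, ?xs) \<in> wit ` (UNIV \<times> UNIV \<times> lists (stage k))"
      by (intro imageI) simp
    then have "wit (\<phi>, n, ?xs) \<in> stage (Suc k)"
      unfolding stage_simps(2) ..
    then have "wit (\<phi>, n, ?xs) \<in> S"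
      unfolding S_def by (rule UN_I[OF UNIV_I])
    moreover have "satisfies M (e(n := wit (\<phi>, n, ?xs))) \<phi>"
      using wit(2)[OF a(1), of ?xs n \<phi>] a(2) unfolding cong by blast
    ultimately show ?thesis by blast
  qed
  note elementary = tarski_vaught[OF M SM \<open>S \<noteq> {}\<close> this]
  show thesis
    by (rule that[OF \<open>countable S\<close> \<open>X \<subseteq> S\<close> elementary])
qed

corollary ex_elementarily_equivalent_copy:
  fixes M :: "'b bf_algebra"
  assumes inf: "infinite (UNIV :: 'a set)" and M: "bf_algebra M"
    and X: "countable X" "X \<subseteq> univ M"
  obtains S h and N :: "'a bf_algebra" where
    "X \<subseteq> S" "subuniverse S M" "isomorphism h (M\<lparr>univ := S\<rparr>) N"
    "elementarily_equivalent M N"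
proof -
  obtain S where S: "countable S" "X \<subseteq> S" "subuniverse S M"
    and el: "\<And>\<phi> e. range e \<subseteq> S \<Longrightarrow> satisfies (M\<lparr>univ := S\<rparr>) e \<phi> \<longleftrightarrow> satisfies M e \<phi>"
    by (rule downward_loewenheim_skolem[OF M X]) (rule that; blast)
  obtain i :: "nat \<Rightarrow> 'a" where "inj i"
    using inf unfolding infinite_iff_countable_subset by auto
  moreover obtain c :: "'b \<Rightarrow> nat" where "inj_on c S"
    using \<open>countable S\<close> by (auto simp: countable_def)
  ultimately have "inj_on (i \<circ> c) (univ (M\<lparr>univ := S\<rparr>))"
    by (auto simp: inj_on_def)
  then obtain N where N: "isomorphism (i \<circ> c) (M\<lparr>univ := S\<rparr>) N"
    using ex_isomorphic_copy by blast
  have "zero M \<in> S"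
    using S by (simp add: subuniverse_def)
  then have "elementarily_equivalent M (M\<lparr>univ := S\<rparr>)"
    using el[of "\<lambda>_. zero M"] by (intro elementarily_equivalentI[of _ "\<lambda>_. zero M" _ "\<lambda>_. zero M"]) auto
  moreover have "bf_algebra (M\<lparr>univ := S\<rparr>)"
    using S(3) by (simp add: bf_algebra_def subuniverse_def)
  then have "elementarily_equivalent (M\<lparr>univ := S\<rparr>) N"
    by (rule isomorphism_elementarily_equivalent[OF N])
  ultimately have "elementarily_equivalent M N"
    by (rule elementarily_equivalent_trans)
  with S N show thesis
    by (intro that)
qed

section \<open>Ultrapowers\<close>

definition ultrafilter :: "'i filter \<Rightarrow> bool" where
  "ultrafilter U \<longleftrightarrow> U \<noteq> bot \<and> (\<forall>P. eventually P U \<or> (\<forall>\<^sub>F i in U. \<not> P i))"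

lemma ultrafilter_not_eventually:
  "ultrafilter U \<Longrightarrow> (\<forall>\<^sub>F i in U. \<not> P i) \<longleftrightarrow> \<not> eventually P U"
  unfolding ultrafilter_def using eventually_conj_iff[of P "\<lambda>i. \<not> P i" U] eventually_False[of U]
  by auto

text \<open>
  In the order of \<^typ>\<open>'i filter\<close> smaller filters make more properties eventually true, so
  ultrafilters are the minimal proper filters, and Zorn's lemma is applied downwards: the infimum
  of a chain of proper filters is proper, since a property that holds eventually for the infimum
  already does so for a member of the chain.
\<close>

theorem ex_ultrafilter_le:
  fixes F :: "'i filter"
  assumes "F \<noteq> bot"
  obtains U where "U \<le> F" "ultrafilter U"
proof -
  let ?A = "{G. G \<le> F \<and> G \<noteq> bot}"
  have "\<exists>U\<in>?A. \<forall>G\<in>?A. G \<le> U \<longrightarrow> G = U"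
  proof (rule predicate_Zorn[of ?A "\<lambda>G H. H \<le> G"])
    show "partial_order_on ?A (relation_of (\<lambda>G H. H \<le> G) ?A)"
      by (rule partial_order_on_relation_ofI) auto
    fix C assume C: "C \<in> Chains (relation_of (\<lambda>G H. H \<le> G) ?A)"
    show "\<exists>u\<in>?A. \<forall>G\<in>C. u \<le> G"
    proof (cases "C = {}")
      case False
      have CA: "C \<subseteq> ?A" and total: "\<And>G H. G \<in> C \<Longrightarrow> H \<in> C \<Longrightarrow> G \<le> H \<or> H \<le> G"
        using C by (auto simp: Chains_def relation_of_def)
      have "eventually P (Inf C) \<longleftrightarrow> (\<exists>G\<in>C. eventually P G)" for P
        proof (rule eventually_Inf_base[OF False])
        show "\<exists>x\<in>C. x \<le> inf G H" if "G \<in> C" "H \<in> C" for G H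
          using total[OF that] that by (auto intro: bexI[of _ G] bexI[of _ H])
      qed
      then have "Inf C \<noteq> bot"
        using CA unfolding trivial_limit_def by blast
      moreover obtain G where "G \<in> C"
        using False by blast
      then have "Inf C \<le> F"
        using CA by (intro Inf_lower2[of G]) auto
      ultimately show ?thesis
        by (auto intro: Inf_lower)
    qed (use assms in auto)
  qed
  then obtain U where U: "U \<le> F" "U \<noteq> bot" and min: "\<And>G. G \<le> U \<Longrightarrow> G \<noteq> bot \<Longrightarrow> G = U"
    by (blast intro: order_trans)
  \<comment> \<open>Restricting \<open>U\<close> to \<open>P\<close> yields the improper filter or, by minimality, \<open>U\<close> itself.\<close>
  have "eventually P U \<or> (\<forall>\<^sub>F i in U. \<not> P i)" for P
  proof (cases "inf U (principal {i. P i}) = bot")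
    case True
    then show ?thesis
      by (simp add: trivial_limit_def eventually_inf_principal)
  next
    case False
    then have "inf U (principal {i. P i}) = U"
      by (intro min) auto
    moreover have "eventually P (inf U (principal {i. P i}))"
      by (simp add: eventually_inf_principal)
    ultimately show ?thesis by simp
  qed
  with U show thesis
    by (intro that) (auto simp: ultrafilter_def)
qed

text \<open>
  Elements of an ultrapower are represented by one chosen function from each class of functions
  that agree almost everywhere. Unlike the classes themselves, these can be evaluated at indices.
\<close>

definition representative :: "'i filter \<Rightarrow> ('i \<Rightarrow> 'a) \<Rightarrow> 'i \<Rightarrow> 'a" where
  "representative U g = (SOME g'. \<forall>\<^sub>F i in U. g' i = g i)"

lemma eventually_representative: "\<forall>\<^sub>F i in U. representative U g i = g i"
  unfolding representative_def by (rule someI[of _ g]) simp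

lemma representative_eq_iff:
  "representative U g = representative U g' \<longleftrightarrow> (\<forall>\<^sub>F i in U. g i = g' i)"
proof
  assume eq: "representative U g = representative U g'"
  show "\<forall>\<^sub>F i in U. g i = g' i"
    using eventually_representative[of U g] eventually_representative[of U g', folded eq]
    by eventually_elim simp
next
  assume "\<forall>\<^sub>F i in U. g i = g' i"
  then have "(\<forall>\<^sub>F i in U. h i = g i) \<longleftrightarrow> (\<forall>\<^sub>F i in U. h i = g' i)" for h
    by (auto elim: eventually_elim2)
  then show "representative U g = representative U g'"
    unfolding representative_def by simp
qed

definition ultrapower :: "'i filter \<Rightarrow> 'a bf_algebra \<Rightarrow> ('i \<Rightarrow> 'a) bf_algebra" where
  "ultrapower U A =
    \<lparr>univ = representative U ` {g. range g \<subseteq> univ A},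
     meet = \<lambda>X Y. representative U (\<lambda>i. meet A (X i) (Y i)),
     compl = \<lambda>X. representative U (\<lambda>i. compl A (X i)),
     zero = representative U (\<lambda>_. zero A),
     oper = \<lambda>X. representative U (\<lambda>i. oper A (X i))\<rparr>"

lemma ultrapower_univ_eq_iff:
  assumes "X \<in> range (representative U)" "Y \<in> range (representative U)"
  shows "X = Y \<longleftrightarrow> (\<forall>\<^sub>F i in U. X i = Y i)"
proof -
  obtain f g where "X = representative U f" "Y = representative U g"
    using assms by blast
  moreover have "(\<forall>\<^sub>F i in U. representative U f i = representative U g i) \<longleftrightarrow> (\<forall>\<^sub>F i in U. f i = g i)"
  proof -
    have "\<forall>\<^sub>F i in U. (representative U f i = representative U g i) = (f i = g i)"
      using eventually_representative[of U f] eventually_representative[of U g]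
      by eventually_elim simp
    then show ?thesis
      by (rule eventually_subst)
  qed
  ultimately show ?thesis
    by (simp add: representative_eq_iff)
qed

text \<open>
  A chosen representative takes values in the algebra almost everywhere only; conversely,
  a function with this property can be changed on a negligible set to take all its values there.
\<close>

lemma bf_algebra_ultrapower:
  assumes "bf_algebra A"
  shows "bf_algebra (ultrapower U A)"
proof -
  have A: "zero A \<in> univ A" "\<And>x y. x \<in> univ A \<Longrightarrow> y \<in> univ A \<Longrightarrow> meet A x y \<in> univ A"
    "\<And>x. x \<in> univ A \<Longrightarrow> compl A x \<in> univ A" "\<And>x. x \<in> univ A \<Longrightarrow> oper A x \<in> univ A"
    using assms by (auto simp: bf_algebra_def subuniverse_def)
  have in_univ: "representative U g \<in> univ (ultrapower U A)"
    if "\<forall>\<^sub>F i in U. g i \<in> univ A" for g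
  proof -
    let ?g = "\<lambda>i. if g i \<in> univ A then g i else zero A"
    have "representative U g = representative U ?g"
      unfolding representative_eq_iff using that by eventually_elim simp
    moreover have "range ?g \<subseteq> univ A"
      using A by auto
    ultimately show ?thesis
      unfolding ultrapower_def by auto
  qed
  have ev: "\<forall>\<^sub>F i in U. X i \<in> univ A" if X: "X \<in> univ (ultrapower U A)" for X
  proof -
    obtain g where "range g \<subseteq> univ A" "X = representative U g"
      using X by (auto simp: ultrapower_def)
    then show ?thesis
      using eventually_representative[of U g] by (auto elim!: eventually_mono)
  qed
  show ?thesis
    unfolding bf_algebra_def subuniverse_def
  proof (intro conjI ballI subset_refl)
    show "zero (ultrapower U A) \<in> univ (ultrapower U A)"
      using in_univ[of "\<lambda>_. zero A"] A by (simp add: ultrapower_def)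
    fix X assume "X \<in> univ (ultrapower U A)"
    note X = ev[OF this]
    show "compl (ultrapower U A) X \<in> univ (ultrapower U A)"
      using in_univ[of "\<lambda>i. compl A (X i)"] X A by (simp add: ultrapower_def eventually_mono)
    show "oper (ultrapower U A) X \<in> univ (ultrapower U A)"
      using in_univ[of "\<lambda>i. oper A (X i)"] X A by (simp add: ultrapower_def eventually_mono)
    fix Y assume "Y \<in> univ (ultrapower U A)"
    note Y = ev[OF this]
    have "\<forall>\<^sub>F i in U. meet A (X i) (Y i) \<in> univ A"
      using X Y by eventually_elim (rule A)
    then show "meet (ultrapower U A) X Y \<in> univ (ultrapower U A)"
      using in_univ[of "\<lambda>i. meet A (X i) (Y i)"] by (simp add: ultrapower_def)
  qed
qed

lemma ultrapower_tm_value: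
  "\<forall>\<^sub>F i in U. tm_value (ultrapower U A) e t i = tm_value A (\<lambda>k. e k i) t"
proof (induction t)
  case Zero
  then show ?case
    using eventually_representative[of U "\<lambda>_. zero A"] by (simp add: ultrapower_def)
next
  case (Compl t)
  show ?case
    using Compl eventually_representative[of U "\<lambda>i. compl A (tm_value (ultrapower U A) e t i)"]
    by eventually_elim (simp add: ultrapower_def)
next
  case (Meet s t)
  show ?case
    using Meet eventually_representative
      [of U "\<lambda>i. meet A (tm_value (ultrapower U A) e s i) (tm_value (ultrapower U A) e t i)"]
    by eventually_elim (simp add: ultrapower_def)
next
  case (Oper t)
  show ?case
    using Oper eventually_representative[of U "\<lambda>i. oper A (tm_value (ultrapower U A) e t i)"]
    by eventually_elim (simp add: ultrapower_def)
qed simp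

text \<open>
  Negation is where the ultrafilter property enters. For a universal quantifier, one function that
  selects a counterexample at each index where there is one decides the matter.
\<close>

theorem los:
  fixes U :: "'i filter" and A :: "'a bf_algebra"
  assumes U: "ultrafilter U" and A: "bf_algebra A"
    and e: "range e \<subseteq> univ (ultrapower U A)"
  shows "satisfies (ultrapower U A) e \<phi> \<longleftrightarrow> (\<forall>\<^sub>F i in U. satisfies A (\<lambda>k. e k i) \<phi>)"
  using e
proof (induction \<phi> arbitrary: e)
  case (Eq s t)
  have "univ (ultrapower U A) \<subseteq> range (representative U)"
    by (auto simp: ultrapower_def)
  then have "tm_value (ultrapower U A) e t \<in> range (representative U)" for t
    using tm_value_in_univ[OF bf_algebra_ultrapower[OF A] Eq] by blast
  moreover have "\<forall>\<^sub>F i in U. (tm_value (ultrapower U A) e s i = tm_value (ultrapower U A) e t i) =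
      (tm_value A (\<lambda>k. e k i) s = tm_value A (\<lambda>k. e k i) t)"
    using ultrapower_tm_value[of U A e s] ultrapower_tm_value[of U A e t] by eventually_elim simp
  ultimately show ?case
    by (simp add: ultrapower_univ_eq_iff[of _ U] eventually_subst)
next
  case (Neg \<phi>)
  then show ?case
    using ultrafilter_not_eventually[OF U] by simp
next
  case (Conj \<phi> \<psi>)
  then show ?case
    by (simp add: eventually_conj_iff)
next
  case (All n \<phi>)
  have upd: "(\<lambda>k. (e(n := a)) k i) = (\<lambda>k. e k i)(n := a i)" for a i
    by auto
  have IH: "satisfies (ultrapower U A) (e(n := a)) \<phi> \<longleftrightarrow>
      (\<forall>\<^sub>F i in U. satisfies A ((\<lambda>k. e k i)(n := a i)) \<phi>)" if "a \<in> univ (ultrapower U A)" for a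
  proof -
    have "range (e(n := a)) \<subseteq> univ (ultrapower U A)"
      using All.prems that by auto
    from All.IH[OF this] show ?thesis
      unfolding upd .
  qed
  have rep: "(\<forall>\<^sub>F i in U. P i (representative U g i)) \<longleftrightarrow> (\<forall>\<^sub>F i in U. P i (g i))"
    for P and g :: "'i \<Rightarrow> 'a"
  proof (rule eventually_subst)
    show "\<forall>\<^sub>F i in U. P i (representative U g i) = P i (g i)"
      using eventually_representative[of U g] by eventually_elim simp
  qed
  have "satisfies (ultrapower U A) e (All n \<phi>) \<longleftrightarrow>
      (\<forall>g. range g \<subseteq> univ A \<longrightarrow> (\<forall>\<^sub>F i in U. satisfies A ((\<lambda>k. e k i)(n := g i)) \<phi>))"
    using IH rep[of "\<lambda>i b. satisfies A ((\<lambda>k. e k i)(n := b)) \<phi>"]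
    by (auto simp: ultrapower_def)
  also have "\<dots> \<longleftrightarrow> (\<forall>\<^sub>F i in U. \<forall>b\<in>univ A. satisfies A ((\<lambda>k. e k i)(n := b)) \<phi>)"
  proof (intro iffI allI impI)
    have zero: "zero A \<in> univ A"
      using A by (simp add: bf_algebra_def subuniverse_def)
    assume *: "\<forall>g. range g \<subseteq> univ A \<longrightarrow>
      (\<forall>\<^sub>F i in U. satisfies A ((\<lambda>k. e k i)(n := g i)) \<phi>)"
    have "\<exists>b\<in>univ A. (\<exists>b\<in>univ A. \<not> satisfies A ((\<lambda>k. e k i)(n := b)) \<phi>) \<longrightarrow>
        \<not> satisfies A ((\<lambda>k. e k i)(n := b)) \<phi>" for i
      using zero by blast
    then obtain g where g: "\<And>i. g i \<in> univ A"
        "\<And>i b. b \<in> univ A \<Longrightarrow> \<not> satisfies A ((\<lambda>k. e k i)(n := b)) \<phi> \<Longrightarrow>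
          \<not> satisfies A ((\<lambda>k. e k i)(n := g i)) \<phi>"
      by metis
    have "\<forall>\<^sub>F i in U. satisfies A ((\<lambda>k. e k i)(n := g i)) \<phi>"
      using * g(1) by blast
    then show "\<forall>\<^sub>F i in U. \<forall>b\<in>univ A. satisfies A ((\<lambda>k. e k i)(n := b)) \<phi>"
      by eventually_elim (use g(2) in blast)
  next
    fix g :: "'i \<Rightarrow> 'a"
    assume "\<forall>\<^sub>F i in U. \<forall>b\<in>univ A. satisfies A ((\<lambda>k. e k i)(n := b)) \<phi>"
      and "range g \<subseteq> univ A"
    then show "\<forall>\<^sub>F i in U. satisfies A ((\<lambda>k. e k i)(n := g i)) \<phi>"
      by (auto elim!: eventually_mono)
  qed
  finally show ?case by simp
qed

corollary elementarily_equivalent_ultrapower: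
  assumes "ultrafilter U" "bf_algebra A"
  shows "elementarily_equivalent A (ultrapower U A)"
proof (rule elementarily_equivalentI)
  fix \<phi> assume \<phi>: "sentence \<phi>"
  let ?e = "\<lambda>_. zero (ultrapower U A)"
  have "range ?e \<subseteq> univ (ultrapower U A)"
    using bf_algebra_ultrapower[OF assms(2)] by (auto simp: bf_algebra_def subuniverse_def)
  then have "satisfies (ultrapower U A) ?e \<phi> \<longleftrightarrow> (\<forall>\<^sub>F i in U. satisfies A (\<lambda>k. ?e k i) \<phi>)"
    by (rule los[OF assms])
  also have "\<dots> \<longleftrightarrow> (\<forall>\<^sub>F i in U. satisfies A (\<lambda>_. zero A) \<phi>)"
    by (intro eventually_subst always_eventually allI satisfies_sentence \<phi>)
  also have "\<dots> \<longleftrightarrow> satisfies A (\<lambda>_. zero A) \<phi>"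
    using assms(1) by (simp add: ultrafilter_def)
  finally show "satisfies A (\<lambda>_. zero A) \<phi> \<longleftrightarrow> satisfies (ultrapower U A) ?e \<phi>" ..
qed


section \<open>Frames in which the operation drives every nonzero element to the unit\<close>

text \<open>
  As \<open>0 = x \<sqinter> -x\<close>, this reduces to the idempotence of the meet.
\<close>

lemma boolean_frame_meet_zero:
  assumes "boolean_frame A" "x \<in> univ A"
  shows "meet A x (zero A) = zero A"
proof -
  have A: "meet A x (compl A x) = zero A" "meet A x (one A) = x"
    "join A x (compl A x) = one A" "compl A x \<in> univ A"
    using assms unfolding boolean_frame_def bf_algebra_def subuniverse_def by auto
  have "x = meet A x (join A x (compl A x))"
    using A by simp
  also have "\<dots> = join A (meet A x x) (meet A x (compl A x))"
    using assms A(4) unfolding boolean_frame_def by blast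
  also have "\<dots> = join A (meet A x x) (zero A)"
    using A by simp
  also have "\<dots> = meet A x x"
    using assms unfolding boolean_frame_def bf_algebra_def subuniverse_def by blast
  finally have "meet A x x = x" ..
  moreover have "meet A (meet A x x) (compl A x) = meet A x (meet A x (compl A x))"
    using assms A(4) unfolding boolean_frame_def by blast
  ultimately show ?thesis
    using A by simp
qed

lemma boolean_frame_eqI:
  assumes A: "boolean_frame A" and xy: "x \<in> univ A" "y \<in> univ A"
    and "meet A x (compl A y) = zero A" "meet A y (compl A x) = zero A"
  shows "x = y"
proof -
  have *: "u = meet A u v"
    if uv: "u \<in> univ A" "v \<in> univ A" and 0: "meet A u (compl A v) = zero A" for u v
  proof -
    have v': "compl A v \<in> univ A" and uv': "meet A u v \<in> univ A"
      using A uv unfolding boolean_frame_def bf_algebra_def subuniverse_def by auto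
    have "u = meet A u (join A v (compl A v))"
      using A uv unfolding boolean_frame_def by simp
    also have "\<dots> = join A (meet A u v) (meet A u (compl A v))"
      using A uv v' unfolding boolean_frame_def by blast
    also have "\<dots> = meet A u v"
      using A uv' unfolding boolean_frame_def 0 by blast
    finally show ?thesis .
  qed
  have "meet A x y = meet A y x"
    using A xy unfolding boolean_frame_def by blast
  then show ?thesis
    using * assms by metis
qed

text \<open>
  The hypothesis passes to subalgebras, which makes each of them simple: a congruence that
  identifies two different elements identifies one of their nonzero differences with 0, hence all
  iterates of it, hence 1. So a congruence of a subalgebra is either equality or everything.
\<close>

theorem congruence_extension_property_if_reaches_one:
  assumes A: "boolean_frame A"
    and zero: "oper A (zero A) = zero A"
    and reaches: "\<And>x. x \<in> univ A \<Longrightarrow> x \<noteq> zero A \<Longrightarrow> \<exists>k. (oper A ^^ k) x = one A"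
  shows "congruence_extension_property A"
  unfolding congruence_extension_property_def
proof (intro allI impI)
  fix \<CC> \<Theta>
  assume "subalgebra \<CC> A" and \<Theta>: "congruence \<CC> \<Theta>"
  then obtain S where S: "subuniverse S A" and \<CC>: "\<CC> = A\<lparr>univ := S\<rparr>"
    unfolding subalgebra_def by blast
  have SA: "x \<in> univ A" if "x \<in> S" for x
    using S that unfolding subuniverse_def by blast
  have A_closed: "zero A \<in> univ A" "\<And>x. x \<in> univ A \<Longrightarrow> compl A x \<in> univ A"
    "\<And>x y. x \<in> univ A \<Longrightarrow> y \<in> univ A \<Longrightarrow> meet A x y \<in> univ A"
    "\<And>x. x \<in> univ A \<Longrightarrow> oper A x \<in> univ A"
    using A unfolding boolean_frame_def bf_algebra_def subuniverse_def by auto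
  have S_closed: "zero A \<in> S" "\<And>x. x \<in> S \<Longrightarrow> compl A x \<in> S"
    using S unfolding subuniverse_def by auto
  have \<Theta>S: "x \<in> S" "y \<in> S" if "(x, y) \<in> \<Theta>" for x y
    using \<Theta> that unfolding \<CC> congruence_def equiv_def by auto
  have refl: "(x, x) \<in> \<Theta>" if "x \<in> S" for x
    using \<Theta> that by (auto simp: \<CC> congruence_def equiv_def refl_on_def)
  have sym: "(y, x) \<in> \<Theta>" if "(x, y) \<in> \<Theta>" for x y
    using \<Theta> that by (auto simp: \<CC> congruence_def equiv_def dest: symD)
  have trans: "(x, z) \<in> \<Theta>" if "(x, y) \<in> \<Theta>" "(y, z) \<in> \<Theta>" for x y z
    using \<Theta> that by (auto simp: \<CC> congruence_def equiv_def dest: transD)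
  have op: "(oper A x, oper A y) \<in> \<Theta>" if "(x, y) \<in> \<Theta>" for x y
    using \<Theta> that unfolding \<CC> congruence_def by auto
  have meet: "(meet A x y, meet A x' y') \<in> \<Theta>" if "(x, x') \<in> \<Theta>" "(y, y') \<in> \<Theta>" for x x' y y'
    using \<Theta> that unfolding \<CC> congruence_def by auto
  show "\<exists>\<Psi>. congruence A \<Psi> \<and> \<Theta> = \<Psi> \<inter> (univ \<CC> \<times> univ \<CC>)"
  proof (cases "\<exists>x. (x, zero A) \<in> \<Theta> \<and> x \<noteq> zero A")
    case True
    then obtain x where x: "(x, zero A) \<in> \<Theta>" "x \<noteq> zero A"
      by blast
    obtain k where k: "(oper A ^^ k) x = one A"
      using reaches SA \<Theta>S x by blast
    have "((oper A ^^ k) x, zero A) \<in> \<Theta>" for k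
    proof (induction k)
      case (Suc k)
      then show ?case
        using op[OF Suc] zero by simp
    qed (simp add: x)
    from this[of k] have one: "(one A, zero A) \<in> \<Theta>"
      using k by simp
    have to_zero: "(x, zero A) \<in> \<Theta>" if "x \<in> S" for x
    proof -
      have "(meet A x (one A), meet A x (zero A)) \<in> \<Theta>"
        by (rule meet[OF refl[OF that] one])
      moreover have "meet A x (one A) = x"
        using A SA[OF that] unfolding boolean_frame_def by blast
      ultimately show ?thesis
        using boolean_frame_meet_zero[OF A SA[OF that]] by simp
    qed
    have "(x, y) \<in> \<Theta>" if "x \<in> S" "y \<in> S" for x y
      by (rule trans[OF to_zero[OF that(1)] sym[OF to_zero[OF that(2)]]])
    then have "S \<times> S \<subseteq> \<Theta>"
      by auto
    moreover have "\<Theta> \<subseteq> S \<times> S"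
      by (intro subrelI SigmaI \<Theta>S)
    ultimately have "\<Theta> = S \<times> S"
      by (rule equalityI[rotated])
    moreover have "congruence A (univ A \<times> univ A)"
      using A_closed by (auto simp: congruence_def intro!: equivI refl_onI symI transI)
    moreover have "S \<times> S = (univ A \<times> univ A) \<inter> (S \<times> S)"
      using SA by blast
    ultimately show ?thesis
      unfolding \<CC> by (intro exI[of _ "univ A \<times> univ A"]) simp
  next
    case False
    have zero_meet: "meet A x (compl A y) = zero A" if "(x, y) \<in> \<Theta>" for x y
    proof -
      have "(meet A x (compl A y), meet A y (compl A y)) \<in> \<Theta>"
        using that \<Theta>S[OF that] S_closed by (intro meet refl) auto
      moreover have "meet A y (compl A y) = zero A"
        using A SA[OF \<Theta>S(2)[OF that]] unfolding boolean_frame_def by blast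
      ultimately show ?thesis
        using False by auto
    qed
    have eq: "x = y" if "(x, y) \<in> \<Theta>" for x y
      by (rule boolean_frame_eqI[OF A SA[OF \<Theta>S(1)[OF that]] SA[OF \<Theta>S(2)[OF that]]
            zero_meet[OF that] zero_meet[OF sym[OF that]]])
    have "\<Theta> \<subseteq> Id_on (univ A) \<inter> (S \<times> S)"
    proof (rule subrelI)
      fix x y assume xy: "(x, y) \<in> \<Theta>"
      show "(x, y) \<in> Id_on (univ A) \<inter> (S \<times> S)"
        using eq[OF xy] \<Theta>S[OF xy] SA[OF \<Theta>S(1)[OF xy]] by (simp add: Id_on_iff)
    qed
    moreover have "Id_on (univ A) \<inter> (S \<times> S) \<subseteq> \<Theta>"
      using refl by (intro subrelI) (simp add: Id_on_iff)
    ultimately have "\<Theta> = Id_on (univ A) \<inter> (S \<times> S)" ..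
    moreover have "congruence A (Id_on (univ A))"
      using A_closed
      by (auto simp: congruence_def Id_on_def intro!: equivI refl_onI symI transI)
    ultimately show ?thesis
      unfolding \<CC> by (intro exI[of _ "Id_on (univ A)"]) simp
  qed
qed

section \<open>The frame of sets of natural numbers with the tail operation\<close>

text \<open>
  Truncated subtraction makes every set other than \<open>{0}\<close> that contains 0 go to \<open>UNIV\<close>. The
  exception at \<open>{0}\<close> makes \<open>{0}\<close> and \<open>{0} \<union> {n..}\<close> have different images for \<open>n > 0\<close>,
  however large \<open>n\<close> is.
\<close>

definition tail_oper :: "nat set \<Rightarrow> nat set" where
  "tail_oper X =
     (if X = {} then {} else if X = {0} then {1..} else {(LEAST n. n \<in> X) - 1..})"

lemma tail_oper_empty: "tail_oper {} = {}"
  by (simp add: tail_oper_def)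

lemma tail_oper_singleton_0: "tail_oper {0} = {1..}"
  by (simp add: tail_oper_def)

lemma tail_oper_0: "0 \<in> X \<Longrightarrow> X \<noteq> {0} \<Longrightarrow> tail_oper X = UNIV"
  by (auto simp: tail_oper_def Least_eq_0)

text \<open>
  One application undoes the emptiness of an initial segment by one place at most. This slowness
  is the reason why the congruence generated by an infinitely remote tail stays small.
\<close>

lemma tail_oper_disjoint:
  assumes "X \<inter> {..<k} = {}"
  shows "tail_oper X \<inter> {..<k - 1} = {}"
proof (cases "X = {} \<or> k = 0")
  case False
  then have "(LEAST n. n \<in> X) \<in> X"
    by (auto intro: LeastI)
  then have "k \<le> (LEAST n. n \<in> X)"
    using assms by (auto simp: not_less[symmetric])
  moreover have "X \<noteq> {0}"
    using False assms by auto
  ultimately show ?thesis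
    by (auto simp: tail_oper_def)
qed (auto simp: tail_oper_def)

text \<open>
  The image of any nonempty set is a tail, and tails descend step by step to \<open>UNIV\<close>.
\<close>

lemma tail_oper_reaches_UNIV:
  assumes "X \<noteq> {}"
  shows "\<exists>k. (tail_oper ^^ k) X = UNIV"
proof -
  have from_tail: "\<exists>k. (tail_oper ^^ k) {m..} = UNIV" for m
  proof (induction m)
    case 0
    have "(tail_oper ^^ 0) {0..} = UNIV" by auto
    then show ?case by blast
  next
    case (Suc m)
    have "(LEAST n. n \<in> {Suc m..}) = Suc m"
      by (rule Least_equality) auto
    then have "tail_oper {Suc m..} = {m..}"
      by (auto simp: tail_oper_def)
    with Suc obtain k where "(tail_oper ^^ Suc k) {Suc m..} = UNIV"
      by (auto simp: funpow_Suc_right simp del: funpow.simps)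
    then show ?case by blast
  qed
  have "\<exists>m. tail_oper X = {m..}"
    using assms by (auto simp: tail_oper_def)
  then obtain m where "tail_oper X = {m..}" ..
  with from_tail[of m] obtain k where "(tail_oper ^^ Suc k) X = UNIV"
    by (auto simp: funpow_Suc_right simp del: funpow.simps)
  then show ?thesis by blast
qed

definition tail_frame :: "nat set bf_algebra" where
  "tail_frame = \<lparr>univ = UNIV, meet = (\<inter>), compl = uminus, zero = {}, oper = tail_oper\<rparr>"

lemma boolean_frame_tail_frame: "boolean_frame tail_frame"
  by (auto simp: boolean_frame_def bf_algebra_def subuniverse_def tail_frame_def join_def one_def)

lemma bf_algebra_tail_frame: "bf_algebra tail_frame"
  using boolean_frame_tail_frame by (simp add: boolean_frame_def)

lemma congruence_extension_property_tail_copy: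
  assumes S: "subuniverse S tail_frame" and h: "isomorphism h (tail_frame\<lparr>univ := S\<rparr>) A"
    and A: "boolean_frame A"
  shows "congruence_extension_property A"
proof (rule congruence_extension_property_if_reaches_one[OF A])
  have S_closed: "{} \<in> S" "\<And>X. X \<in> S \<Longrightarrow> tail_oper X \<in> S"
    using S by (auto simp: subuniverse_def tail_frame_def)
  have hom: "zero A = h {}" "\<And>X. X \<in> S \<Longrightarrow> compl A (h X) = h (- X)"
      "\<And>X. X \<in> S \<Longrightarrow> oper A (h X) = h (tail_oper X)" "univ A = h ` S"
    using h by (auto simp: isomorphism_def tail_frame_def bij_betw_def)
  show "oper A (zero A) = zero A"
    using hom S_closed by (simp add: tail_oper_empty)
  fix x assume "x \<in> univ A" "x \<noteq> zero A"
  then obtain X where X: "X \<in> S" "x = h X" "X \<noteq> {}"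
    using hom by auto
  have iter: "(tail_oper ^^ k) X \<in> S \<and> (oper A ^^ k) (h X) = h ((tail_oper ^^ k) X)" for k
    using X hom S_closed by (induction k) auto
  obtain k where "(tail_oper ^^ k) X = UNIV"
    using tail_oper_reaches_UNIV X by blast
  then have "(oper A ^^ k) x = one A"
    using iter[of k] X hom S_closed by (simp add: one_def)
  then show "\<exists>k. (oper A ^^ k) x = one A" ..
qed

section \<open>Failure of congruence extension in the ultrapower\<close>

text \<open>
  With \<open>\<omega>\<close> the infinite number represented by the identity, this is equality below
  \<open>\<omega> - k\<close> for some standard \<open>k\<close>. The number \<open>k\<close> has to be allowed to vary, because the
  tail operation moves the bound by one.
\<close>

definition initially_equal :: "nat filter \<Rightarrow> (nat \<Rightarrow> nat set) \<Rightarrow> (nat \<Rightarrow> nat set) \<Rightarrow> bool" where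
  "initially_equal U X Y \<longleftrightarrow> (\<exists>k. \<forall>\<^sub>F n in U. X n \<inter> {..<n - k} = Y n \<inter> {..<n - k})"

lemma initially_equalI:
  "\<forall>\<^sub>F n in U. X n \<inter> {..<n - k} = Y n \<inter> {..<n - k} \<Longrightarrow> initially_equal U X Y"
  unfolding initially_equal_def by blast

lemma initially_equal_eventually_eq:
  "\<forall>\<^sub>F n in U. X n = Y n \<Longrightarrow> initially_equal U X Y"
  by (rule initially_equalI[where k = 0]) (auto elim: eventually_mono)

lemma initially_equal_refl: "initially_equal U X X"
  by (rule initially_equalI[where k = 0]) simp

lemma initially_equal_sym: "initially_equal U X Y \<Longrightarrow> initially_equal U Y X"
  unfolding initially_equal_def by (simp add: eq_commute)

lemma initially_equal_representative: "initially_equal U (representative U X) X"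
  by (rule initially_equal_eventually_eq[OF eventually_representative])

lemma initially_equal_common_bound:
  assumes "initially_equal U X Y" "initially_equal U X' Y'"
  obtains k where "\<forall>\<^sub>F n in U. X n \<inter> {..<n - k} = Y n \<inter> {..<n - k} \<and>
    X' n \<inter> {..<n - k} = Y' n \<inter> {..<n - k}"
proof -
  obtain i where i: "\<forall>\<^sub>F n in U. X n \<inter> {..<n - i} = Y n \<inter> {..<n - i}"
    using assms(1) unfolding initially_equal_def ..
  obtain j where j: "\<forall>\<^sub>F n in U. X' n \<inter> {..<n - j} = Y' n \<inter> {..<n - j}"
    using assms(2) unfolding initially_equal_def ..
  have shrink: "V \<inter> {..<n - max i j} = W \<inter> {..<n - max i j}"
    if "V \<inter> {..<n - l} = W \<inter> {..<n - l}" "l \<le> max i j" for V W l and n :: nat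
  proof -
    have "{..<n - max i j} = {..<n - l} \<inter> {..<n - max i j}"
      using that(2) by auto
    then show ?thesis
      using that(1) by (metis Int_assoc)
  qed
  show thesis
  proof (rule that)
    show "\<forall>\<^sub>F n in U. X n \<inter> {..<n - max i j} = Y n \<inter> {..<n - max i j} \<and>
        X' n \<inter> {..<n - max i j} = Y' n \<inter> {..<n - max i j}"
      using i j
    proof eventually_elim
      case (elim n)
      then show ?case
        using shrink[OF elim(1)] shrink[OF elim(2)] by simp
    qed
  qed
qed

lemma initially_equal_trans:
  assumes "initially_equal U X Y" "initially_equal U Y Z"
  shows "initially_equal U X Z"
proof -
  obtain k where "\<forall>\<^sub>F n in U. X n \<inter> {..<n - k} = Y n \<inter> {..<n - k} \<and>
      Y n \<inter> {..<n - k} = Z n \<inter> {..<n - k}"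
    using initially_equal_common_bound[OF assms] .
  then have "\<forall>\<^sub>F n in U. X n \<inter> {..<n - k} = Z n \<inter> {..<n - k}"
    by eventually_elim simp
  then show ?thesis
    by (rule initially_equalI)
qed

lemma initially_equal_Int:
  assumes "initially_equal U X X'" "initially_equal U Y Y'"
  shows "initially_equal U (\<lambda>n. X n \<inter> Y n) (\<lambda>n. X' n \<inter> Y' n)"
proof -
  obtain k where "\<forall>\<^sub>F n in U. X n \<inter> {..<n - k} = X' n \<inter> {..<n - k} \<and>
      Y n \<inter> {..<n - k} = Y' n \<inter> {..<n - k}"
    using initially_equal_common_bound[OF assms] .
  then have "\<forall>\<^sub>F n in U. (X n \<inter> Y n) \<inter> {..<n - k} = (X' n \<inter> Y' n) \<inter> {..<n - k}"
    by eventually_elim blast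
  then show ?thesis
    by (rule initially_equalI)
qed

lemma initially_equal_Compl:
  assumes "initially_equal U X Y"
  shows "initially_equal U (\<lambda>n. - X n) (\<lambda>n. - Y n)"
proof -
  obtain k where "\<forall>\<^sub>F n in U. X n \<inter> {..<n - k} = Y n \<inter> {..<n - k}"
    using assms unfolding initially_equal_def ..
  then have "\<forall>\<^sub>F n in U. - X n \<inter> {..<n - k} = - Y n \<inter> {..<n - k}"
    by eventually_elim blast
  then show ?thesis
    by (rule initially_equalI)
qed

lemma initially_equal_tail_oper_empty:
  assumes "initially_equal U X (\<lambda>_. {})"
  shows "initially_equal U (\<lambda>n. tail_oper (X n)) (\<lambda>_. {})"
proof -
  obtain k where "\<forall>\<^sub>F n in U. X n \<inter> {..<n - k} = {}"
    using assms unfolding initially_equal_def Int_empty_left ..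
  then have "\<forall>\<^sub>F n in U. tail_oper (X n) \<inter> {..<n - Suc k} = {} \<inter> {..<n - Suc k}"
  proof eventually_elim
    case (elim n)
    from tail_oper_disjoint[OF this] show ?case by simp
  qed
  then show ?thesis
    by (rule initially_equalI)
qed

lemma initially_equal_tail_oper_UNIV:
  assumes "U \<le> sequentially" "initially_equal U X (\<lambda>_. UNIV)"
  shows "initially_equal U (\<lambda>n. tail_oper (X n)) (\<lambda>_. UNIV)"
proof -
  obtain k where k: "\<forall>\<^sub>F n in U. X n \<inter> {..<n - k} = {..<n - k}"
    using assms(2) unfolding initially_equal_def Int_UNIV_left ..
  have "\<forall>\<^sub>F n in U. k + 2 \<le> n"
    by (rule filter_leD[OF assms(1) eventually_ge_at_top])
  with k have "\<forall>\<^sub>F n in U. tail_oper (X n) = UNIV"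
  proof eventually_elim
    case (elim n)
    then have "{..<n - k} \<subseteq> X n" "{0, 1} \<subseteq> {..<n - k}"
      by auto
    then have "{0, 1} \<subseteq> X n"
      by (rule order_trans[rotated])
    then show ?case
      by (intro tail_oper_0) auto
  qed
  then show ?thesis
    by (rule initially_equal_eventually_eq)
qed

lemma not_initially_equal_UNIV_empty:
  assumes "U \<le> sequentially" "U \<noteq> bot"
  shows "\<not> initially_equal U (\<lambda>_. UNIV) (\<lambda>_. {})"
proof
  assume "initially_equal U (\<lambda>_. UNIV) (\<lambda>_. {})"
  then obtain k where "\<forall>\<^sub>F n in U. {..<n - k} = {}"
    unfolding initially_equal_def Int_UNIV_left Int_empty_left by (elim exE)
  moreover have "\<forall>\<^sub>F n in U. k < n"
    by (rule filter_leD[OF assms(1) eventually_gt_at_top])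
  ultimately have "\<forall>\<^sub>F n in U. False"
    by eventually_elim (simp add: lessThan_empty_iff)
  then show False
    using assms(2) by (simp add: eventually_False)
qed


lemma initially_equal_representative_left:
  "initially_equal U (representative U X) Y \<longleftrightarrow> initially_equal U X Y"
  using initially_equal_trans[OF initially_equal_representative]
    initially_equal_trans[OF initially_equal_sym[OF initially_equal_representative]] by (rule iffI[rotated])

lemma initially_equal_representative_right:
  "initially_equal U Y (representative U X) \<longleftrightarrow> initially_equal U Y X"
  using initially_equal_representative_left[of U X Y]
    initially_equal_sym[of U Y] initially_equal_sym[of U _ Y] by blast

text \<open>
  The restriction to sets that are initially empty or initially full is essential: \<open>{0}\<close> and
  \<open>{0} \<union> {n..}\<close> are initially equal, but their images differ at 0.
\<close>

lemma initially_equal_tail_oper: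
  assumes "U \<le> sequentially" "initially_equal U X Y"
    and "initially_equal U X (\<lambda>_. {}) \<or> initially_equal U X (\<lambda>_. UNIV)"
  shows "initially_equal U (\<lambda>n. tail_oper (X n)) (\<lambda>n. tail_oper (Y n))"
  using assms(3)
proof
  assume X: "initially_equal U X (\<lambda>_. {})"
  then have "initially_equal U Y (\<lambda>_. {})"
    using initially_equal_sym[OF assms(2)] by (rule initially_equal_trans[rotated])
  from initially_equal_tail_oper_empty[OF X] initially_equal_tail_oper_empty[OF this]
  show ?thesis
    by (rule initially_equal_trans[OF _ initially_equal_sym])
next
  assume X: "initially_equal U X (\<lambda>_. UNIV)"
  then have "initially_equal U Y (\<lambda>_. UNIV)"
    using initially_equal_sym[OF assms(2)] by (rule initially_equal_trans[rotated])
  from initially_equal_tail_oper_UNIV[OF assms(1) X] initially_equal_tail_oper_UNIV[OF assms(1) this]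
  show ?thesis
    by (rule initially_equal_trans[OF _ initially_equal_sym])
qed

text \<open>
  Call the two given elements \<open>N\<close> and \<open>Z\<close>. Identifying \<open>N\<close> with 0 is harmless in the
  subalgebra of the initially empty or full sets, whose quotient has two elements, but it collapses
  every subalgebra that contains \<open>N\<close> and \<open>Z\<close>, as \<open>Z \<squnion> N\<close> and \<open>Z\<close> have different images. The ultrapower is
  replaced by an arbitrary subalgebra because a countable one has to be used.
\<close>

theorem not_congruence_extension_property_tail_ultrapower:
  assumes U: "U \<le> sequentially" "U \<noteq> bot"
    and S: "subuniverse S (ultrapower U tail_frame)"
    and N: "representative U (\<lambda>n. {n..}) \<in> S" and Z: "representative U (\<lambda>_. {0}) \<in> S"
  shows "\<not> congruence_extension_property ((ultrapower U tail_frame)\<lparr>univ := S\<rparr>)"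
proof
  let ?M = "ultrapower U tail_frame"
  let ?N = "representative U (\<lambda>n. {n..})" and ?Z = "representative U (\<lambda>_. {0})"
  let ?near = "initially_equal U"
  assume cep: "congruence_extension_property (?M\<lparr>univ := S\<rparr>)"
  have ops: "meet ?M X Y = representative U (\<lambda>n. X n \<inter> Y n)"
    "compl ?M X = representative U (\<lambda>n. - X n)"
    "oper ?M X = representative U (\<lambda>n. tail_oper (X n))"
    "zero ?M = representative U (\<lambda>_. {})" for X Y
    by (simp_all add: ultrapower_def tail_frame_def)
  note near_rep = initially_equal_representative_left initially_equal_representative_right
  define C where "C = {X \<in> S. ?near X (\<lambda>_. {}) \<or> ?near X (\<lambda>_. UNIV)}"
  define \<Theta> where "\<Theta> = {(X, Y). X \<in> C \<and> Y \<in> C \<and> ?near X Y}"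
  have S_closed: "zero ?M \<in> S" "\<And>X Y. X \<in> S \<Longrightarrow> Y \<in> S \<Longrightarrow> meet ?M X Y \<in> S"
    "\<And>X. X \<in> S \<Longrightarrow> compl ?M X \<in> S" "\<And>X. X \<in> S \<Longrightarrow> oper ?M X \<in> S"
    using S unfolding subuniverse_def by auto
  have C_meet: "meet ?M X Y \<in> C" if "X \<in> C" "Y \<in> C" for X Y
  proof -
    have "?near X (\<lambda>_. V) \<Longrightarrow> ?near Y (\<lambda>_. W) \<Longrightarrow> ?near (meet ?M X Y) (\<lambda>_. V \<inter> W)" for V W
      using initially_equal_Int[of U X "\<lambda>_. V" Y "\<lambda>_. W"] by (simp add: ops near_rep)
    from this[of "{}" "{}"] this[of "{}" UNIV] this[of UNIV "{}"] this[of UNIV UNIV]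
    show ?thesis
      using that S_closed(2) unfolding C_def by auto
  qed
  have C_compl: "compl ?M X \<in> C" if "X \<in> C" for X
  proof -
    have "?near X (\<lambda>_. V) \<Longrightarrow> ?near (compl ?M X) (\<lambda>_. - V)" for V
      using initially_equal_Compl[of U X "\<lambda>_. V"] by (simp add: ops near_rep)
    from this[of "{}"] this[of UNIV] show ?thesis
      using that S_closed(3) unfolding C_def by auto
  qed
  have C_oper: "oper ?M X \<in> C" if "X \<in> C" for X
  proof -
    have "?near X (\<lambda>_. {}) \<Longrightarrow> ?near (oper ?M X) (\<lambda>_. {})"
      "?near X (\<lambda>_. UNIV) \<Longrightarrow> ?near (oper ?M X) (\<lambda>_. UNIV)"
      using initially_equal_tail_oper_empty[of U X] initially_equal_tail_oper_UNIV[OF U(1), of X]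
      by (simp_all add: ops near_rep)
    then show ?thesis
      using that S_closed(4) unfolding C_def by auto
  qed
  have C_zero: "zero ?M \<in> C"
    using S_closed(1) by (simp add: C_def ops near_rep initially_equal_refl)
  have "subuniverse C (?M\<lparr>univ := S\<rparr>)"
    using C_zero C_meet C_compl C_oper by (auto simp: subuniverse_def C_def)
  then have "subalgebra (?M\<lparr>univ := C\<rparr>) (?M\<lparr>univ := S\<rparr>)"
    unfolding subalgebra_def by (intro exI[of _ C]) simp
  moreover have "congruence (?M\<lparr>univ := C\<rparr>) \<Theta>"
  proof -
    have "equiv C \<Theta>"
    proof (rule equivI)
      show "trans \<Theta>"
        unfolding \<Theta>_def by (rule transI) (use initially_equal_trans in blast)
      show "sym \<Theta>"
        unfolding \<Theta>_def by (rule symI) (use initially_equal_sym in blast)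
    qed (auto simp: \<Theta>_def refl_on_def initially_equal_refl)
    moreover have "(meet ?M X Y, meet ?M X' Y') \<in> \<Theta>" if "(X, X') \<in> \<Theta>" "(Y, Y') \<in> \<Theta>" for X X' Y Y'
      using that C_meet initially_equal_Int[of U X X' Y Y'] by (simp add: \<Theta>_def ops near_rep)
    moreover have "(compl ?M X, compl ?M X') \<in> \<Theta>" if "(X, X') \<in> \<Theta>" for X X'
      using that C_compl initially_equal_Compl[of U X X'] by (simp add: \<Theta>_def ops near_rep)
    moreover have "(oper ?M X, oper ?M X') \<in> \<Theta>" if X: "(X, X') \<in> \<Theta>" for X X'
    proof -
      have "?near (\<lambda>n. tail_oper (X n)) (\<lambda>n. tail_oper (X' n))"
        using X by (intro initially_equal_tail_oper[OF U(1)]) (auto simp: \<Theta>_def C_def)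
      then show ?thesis
        using X C_oper by (simp add: \<Theta>_def ops near_rep)
    qed
    ultimately show ?thesis
      unfolding congruence_def by auto
  qed
  ultimately obtain \<Psi> where \<Psi>: "congruence (?M\<lparr>univ := S\<rparr>) \<Psi>" and \<Theta>\<Psi>: "\<Theta> = \<Psi> \<inter> (C \<times> C)"
    using cep unfolding congruence_extension_property_def by fastforce
  have \<Psi>_refl: "(X, X) \<in> \<Psi>" if "X \<in> S" for X
    using \<Psi> that by (auto simp: congruence_def equiv_def refl_on_def)
  have \<Psi>_meet: "(meet ?M X Y, meet ?M X' Y') \<in> \<Psi>" if "(X, X') \<in> \<Psi>" "(Y, Y') \<in> \<Psi>" for X X' Y Y'
    using \<Psi> that unfolding congruence_def by auto
  have \<Psi>_compl: "(compl ?M X, compl ?M X') \<in> \<Psi>" if "(X, X') \<in> \<Psi>" for X X'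
    using \<Psi> that unfolding congruence_def by auto
  have \<Psi>_oper: "(oper ?M X, oper ?M X') \<in> \<Psi>" if "(X, X') \<in> \<Psi>" for X X'
    using \<Psi> that unfolding congruence_def by auto
  have rep: "\<forall>\<^sub>F n in U. representative U X n = X n" for X :: "nat \<Rightarrow> nat set"
    by (rule eventually_representative)
  have "?near ?N (\<lambda>_. {})"
  proof -
    have "?near (\<lambda>n. {n..}) (\<lambda>_. {})"
      by (rule initially_equalI[where k = 0]) (auto intro!: always_eventually)
    then show ?thesis
      by (simp add: near_rep)
  qed
  then have "(?N, zero ?M) \<in> \<Theta>"
    using N C_zero by (simp add: \<Theta>_def C_def ops near_rep)
  then have "(?N, zero ?M) \<in> \<Psi>"
    using \<Theta>\<Psi> by blast
  \<comment> \<open>Join with \<open>Z\<close>: this relates \<open>{0} \<union> N\<close> to \<open>{0}\<close>.\<close>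
  then have "(compl ?M (meet ?M (compl ?M ?Z) (compl ?M ?N)),
      compl ?M (meet ?M (compl ?M ?Z) (compl ?M (zero ?M)))) \<in> \<Psi>"
    using Z S_closed by (intro \<Psi>_compl \<Psi>_meet \<Psi>_refl)
  moreover have "compl ?M (meet ?M (compl ?M ?Z) (compl ?M ?N)) = representative U (\<lambda>n. insert 0 {n..})"
  proof -
    have "\<forall>\<^sub>F n in U. - meet ?M (compl ?M ?Z) (compl ?M ?N) n = insert 0 {n..}"
      using rep[of "\<lambda>n. {n..}"] rep[of "\<lambda>_. {0}"] rep[of "\<lambda>n. - ?Z n"] rep[of "\<lambda>n. - ?N n"]
        rep[of "\<lambda>n. compl ?M ?Z n \<inter> compl ?M ?N n"]
      unfolding ops by eventually_elim simp
    then show ?thesis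
      unfolding ops(2)[of "meet _ _ _"] by (simp add: representative_eq_iff)
  qed
  moreover have "compl ?M (meet ?M (compl ?M ?Z) (compl ?M (zero ?M))) = ?Z"
  proof -
    have "\<forall>\<^sub>F n in U. - meet ?M (compl ?M ?Z) (compl ?M (zero ?M)) n = {0}"
      using rep[of "\<lambda>n. {}"] rep[of "\<lambda>_. {0}"] rep[of "\<lambda>n. - ?Z n"] rep[of "\<lambda>n. - zero ?M n"]
        rep[of "\<lambda>n. compl ?M ?Z n \<inter> compl ?M (zero ?M) n"]
      unfolding ops by eventually_elim simp
    then show ?thesis
      unfolding ops(2)[of "meet _ _ _"] by (simp add: representative_eq_iff)
  qed
  ultimately have "(representative U (\<lambda>n. insert 0 {n..}), ?Z) \<in> \<Psi>"
    by simp
  \<comment> \<open>The images are \<open>UNIV\<close> and \<open>{1..}\<close>, with complements \<open>{}\<close> and \<open>{0}\<close>.\<close>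
  from \<Psi>_compl[OF \<Psi>_oper[OF this]]
  have "(compl ?M (oper ?M (representative U (\<lambda>n. insert 0 {n..}))), compl ?M (oper ?M ?Z)) \<in> \<Psi>" .
  moreover have "compl ?M (oper ?M (representative U (\<lambda>n. insert 0 {n..}))) = zero ?M"
  proof -
    have "\<forall>\<^sub>F n in U. (1::nat) \<le> n"
      by (rule filter_leD[OF U(1) eventually_ge_at_top])
    then have "\<forall>\<^sub>F n in U. - oper ?M (representative U (\<lambda>n. insert 0 {n..})) n = {}"
      using rep[of "\<lambda>n. insert 0 {n..}"]
        rep[of "\<lambda>n. tail_oper (representative U (\<lambda>n. insert 0 {n..}) n)"]
      unfolding ops
    proof eventually_elim
      case (elim n)
      have "tail_oper (insert 0 {n..}) = UNIV"
        using elim(1) by (intro tail_oper_0) auto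
      with elim show ?case by simp
    qed
    then show ?thesis
      unfolding ops(2)[of "oper _ _"] ops(4) by (simp add: representative_eq_iff)
  qed
  moreover have "compl ?M (oper ?M ?Z) = ?Z"
  proof -
    have "\<forall>\<^sub>F n in U. - oper ?M ?Z n = {0}"
      using rep[of "\<lambda>_. {0}"] rep[of "\<lambda>n. tail_oper (?Z n)"]
      unfolding ops by eventually_elim (auto simp: tail_oper_singleton_0)
    then show ?thesis
      unfolding ops(2)[of "oper _ _"] by (simp add: representative_eq_iff)
  qed
  ultimately have "(zero ?M, ?Z) \<in> \<Psi>"
    by simp
  \<comment> \<open>The operation fixes \<open>{}\<close> and leads from \<open>{0}\<close> via \<open>{1..}\<close> to \<open>UNIV\<close>.\<close>
  from \<Psi>_oper[OF \<Psi>_oper[OF this]]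
  have "(oper ?M (oper ?M (zero ?M)), oper ?M (oper ?M ?Z)) \<in> \<Psi>" .
  moreover have "oper ?M (oper ?M (zero ?M)) = zero ?M"
  proof -
    have "\<forall>\<^sub>F n in U. tail_oper (oper ?M (zero ?M) n) = {}"
      using rep[of "\<lambda>_. {}"] rep[of "\<lambda>n. tail_oper (zero ?M n)"]
      unfolding ops by eventually_elim (simp add: tail_oper_empty)
    then show ?thesis
      unfolding ops(3)[of "oper _ _"] ops(4) by (simp add: representative_eq_iff)
  qed
  moreover have "oper ?M (oper ?M ?Z) = compl ?M (zero ?M)"
  proof -
    have tail_1: "tail_oper {Suc 0..} = UNIV"
    proof -
      have "(LEAST n. n \<in> {Suc 0..}) = Suc 0"
        by (rule Least_equality) auto
      then show ?thesis
        by (auto simp: tail_oper_def)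
    qed
    have "\<forall>\<^sub>F n in U. tail_oper (oper ?M ?Z n) = - zero ?M n"
      using rep[of "\<lambda>_. {}"] rep[of "\<lambda>_. {0}"] rep[of "\<lambda>n. tail_oper (?Z n)"]
      unfolding ops by eventually_elim (simp add: tail_oper_singleton_0 tail_1)
    then show ?thesis
      unfolding ops(3)[of "oper _ _"] ops(2) by (simp add: representative_eq_iff)
  qed
  ultimately have "(zero ?M, compl ?M (zero ?M)) \<in> \<Psi>"
    by simp
  then have "(zero ?M, compl ?M (zero ?M)) \<in> \<Theta>"
    using \<Theta>\<Psi> C_zero C_compl by blast
  then have "?near (zero ?M) (compl ?M (zero ?M))"
    by (simp add: \<Theta>_def)
  moreover have "?near (compl ?M (zero ?M)) (\<lambda>_. UNIV)" "?near (zero ?M) (\<lambda>_. {})"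
    using initially_equal_Compl[of U "zero ?M" "\<lambda>_. {}"]
    by (simp_all add: ops near_rep initially_equal_refl)
  ultimately have "?near (\<lambda>_. UNIV) (\<lambda>_. {})"
    using initially_equal_trans[OF initially_equal_sym initially_equal_trans]
      initially_equal_sym by blast
  then show False
    using not_initially_equal_UNIV_empty[OF U] by simp
qed

section \<open>Non-axiomatizability\<close>

theorem theorem5p5:
  assumes "infinite (UNIV :: 'a set)"
  shows "\<not> elementary (CEP :: 'a bf_algebra set) \<and> \<not> elementary (non_CEP :: 'a bf_algebra set)"
proof -
  obtain U :: "nat filter" where U: "U \<le> sequentially" "ultrafilter U"
    using ex_ultrafilter_le[OF sequentially_bot] .
  let ?M = "ultrapower U tail_frame"
  let ?X = "{representative U (\<lambda>n. {n..}), representative U (\<lambda>_. {0})}"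
  have M: "bf_algebra ?M"
    by (rule bf_algebra_ultrapower[OF bf_algebra_tail_frame])
  have "countable ?X" "?X \<subseteq> univ ?M"
    by (auto simp: ultrapower_def tail_frame_def)
  from ex_elementarily_equivalent_copy[OF assms M this] obtain S h and B :: "'a bf_algebra"
    where S: "?X \<subseteq> S" "subuniverse S ?M" and h: "isomorphism h (?M\<lparr>univ := S\<rparr>) B"
      and MB: "elementarily_equivalent ?M B" .
  have "countable ({} :: nat set set)" "{} \<subseteq> univ tail_frame"
    by auto
  from ex_elementarily_equivalent_copy[OF assms bf_algebra_tail_frame this]
  obtain T g and A :: "'a bf_algebra"
    where T: "subuniverse T tail_frame" and g: "isomorphism g (tail_frame\<lparr>univ := T\<rparr>) A"
      and tA: "elementarily_equivalent tail_frame A" .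
  have AB: "elementarily_equivalent A B"
    using elementarily_equivalent_ultrapower[OF U(2) bf_algebra_tail_frame] MB tA
    by (meson elementarily_equivalent_sym elementarily_equivalent_trans)
  have restrict: "bf_algebra (?M\<lparr>univ := S\<rparr>)" "bf_algebra (tail_frame\<lparr>univ := T\<rparr>)"
    using S(2) T by (auto simp: bf_algebra_def subuniverse_def)
  have A: "boolean_frame A"
    using boolean_frame_elementarily_equivalent[OF boolean_frame_tail_frame _ tA]
      isomorphism_bf_algebra[OF g restrict(2)] .
  have B: "boolean_frame B"
    using boolean_frame_elementarily_equivalent[OF A isomorphism_bf_algebra[OF h restrict(1)] AB] .
  have "A \<in> CEP"
    using A congruence_extension_property_tail_copy[OF T g A] by (simp add: CEP_def)
  moreover have "\<not> congruence_extension_property (?M\<lparr>univ := S\<rparr>)"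
    using U S by (intro not_congruence_extension_property_tail_ultrapower)
      (auto simp: ultrafilter_def)
  then have "B \<in> non_CEP"
    using B congruence_extension_property_isomorphism[OF h restrict(1)]
    by (auto simp: non_CEP_def)
  moreover have "bf_algebra A" "bf_algebra B"
    using A B by (auto simp: boolean_frame_def)
  moreover have "(CEP :: 'a bf_algebra set) \<inter> non_CEP = {}"
    by (auto simp: CEP_def non_CEP_def)
  ultimately show ?thesis
    using elementary_closed[of CEP A B] elementary_closed[of non_CEP B A]
      AB elementarily_equivalent_sym[OF AB] by blast
qed

end
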